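(* Let $\Bbbk$ be a field of characteristic zero and let $\mathrm{Vir}=\Bbbk[T]v$ be the Virasoro Lie conformal algebra, i.e., the free $\Bbbk[T]$-module of rank one with $[v{}_{(\lambda)}v]=(T+2\lambda)v$. Let $P=\Bbbk[v]$ be the polynomial algebra with derivation $d=\frac{d}{dv}$ (and zero Poisson bracket), let $L_v\in\mathrm{End}\,P$ be multiplication by $v$, and let $A(V)$ be the associative conformal subalgebra of $\mathrm{Cend}_{\mathrm{fin}}(\Bbbk[T]\otimes P)$ generated by the element $$\tau(v)=x\otimes\mathrm{id}-T\otimes(d+\mathrm{id})L_v .$$ Then $A(V)$ is isomorphic, as an associative conformal algebra, to the universal associative enveloping conformal algebra $\mathcal U(\mathrm{Vir};3)$ of $\mathrm{Vir}$ relative to the locality bound $N=3$ on the generator $v$.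
   Context: $\Bbbk$ is a field of characteristic $0$ and $H=\Bbbk[T]$. A Lie conformal algebra is an $H$-module $C$ with a linear map $[\cdot{}_{(\lambda)}\cdot]:C\otimes C\to C[\lambda]$ such that $[Ta{}_{(\lambda)}b]=-\lambda[a{}_{(\lambda)}b]$, $[a{}_{(\lambda)}Tb]=(T+\lambda)[a{}_{(\lambda)}b]$; $[a{}_{(\lambda)}b]=-[b{}_{(-T-\lambda)}a]$; $[[a{}_{(\lambda)}b]{}_{(\lambda+\mu)}c]=[a{}_{(\lambda)}[b{}_{(\mu)}c]]-[b{}_{(\mu)}[a{}_{(\lambda)}c]]$. An associative conformal algebra is an $H$-module $A$ with a linear map $(\cdot{}_{(\lambda)}\cdot):A\otimes A\to A[\lambda]$ such that $(Ta{}_{(\lambda)}b)=-\lambda(a{}_{(\lambda)}b)$, $(a{}_{(\lambda)}Tb)=(T+\lambda)(a{}_{(\lambda)}b)$, and $((a{}_{(\lambda)}b){}_{(\lambda+\mu)}c)=(a{}_{(\lambda)}(b{}_{(\mu)}c))$. Write $(a{}_{(\lambda)}b)=\sum_{n\ge0}\frac{\lambda^n}{n!}(a{}_{(n)}b)$. A subalgebra is an $H$-submodule closed under all $n$-products. The locality is $N(a,b)=\deg_\lambda(a{}_{(\lambda)}b)+1$ if $(a{}_{(\lambda)}b)\ne0$ and $N(a,b)=0$ otherwise. $A^{(-)}$ denotes the Lie conformal algebra on $A$ with bracket $[a{}_{(\lambda)}b]=(a{}_{(\lambda)}b)-(b{}_{(-T-\lambda)}a)$. For a vector space $P$, $\mathrm{Cend}_{\mathrm{fin}}(H\otimes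 P)$ is the associative conformal algebra $\Bbbk[T,x]\otimes\mathrm{End}(P)$ (an $H$-module via multiplication by $T$) with $$(f(T,x)\otimes\alpha){}_{(\lambda)}(g(T,x)\otimes\beta)=f(-\lambda,x)\,g(T+\lambda,x+\lambda)\otimes\alpha\beta .$$ It acts on $H\otimes P$ by $(f(T,x)\otimes\alpha)_\mu(h(T)\otimes u)=f(-\mu,T)h(T+\mu)\otimes\alpha(u)$. An associative enveloping conformal algebra of a Lie conformal algebra $C$ is a pair $(A,\tau)$ with $A$ an associative conformal algebra and $\tau:C\to A^{(-)}$ a homomorphism of Lie conformal algebras such that $\tau(C)$ generates $A$ as an associative conformal algebra. The universal envelope $(\mathcal U(\mathrm{Vir};3),\tau_U)$ is the associative enveloping conformal algebra of $\mathrm{Vir}$ with $N(\tau_U(v),\tau_U(v))\le3$ such that for every associative enveloping conformal algebra $(A,\tau)$ of $\mathrm{Vir}$ with $N(\tau(v),\tau(v))\le 3$ there is a homomorphism of associative conformal algebras $\varphi:\mathcal U(\mathrm{Vir};3)\to A$ with $\tau=\varphi\circ\tau_U$. It is known to exist. *)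

theory Defs
  imports "HOL-Algebra.Module" "HOL-Computational_Algebra.Polynomial"
begin

section \<open>Conformal algebras over \<open>H = \<k>[T]\<close>\<close>

text \<open>Both \<open>HOL-Algebra\<close> and \<open>HOL-Computational_Algebra\<close> have a constant \<open>smult\<close>;
  the latter is always written \<open>Polynomial.smult\<close> below, the former \<open>\<odot>\<close>.\<close>

definition H_ring :: "'k::field_char_0 poly ring" where
  "H_ring = \<lparr>carrier = UNIV, monoid.mult = (*), one = 1, ring.zero = 0, add = (+)\<rparr>"

abbreviation T_H :: "'k::field_char_0 poly" where
  "T_H \<equiv> [:0, 1:]"

text \<open>An element of \<open>C[\<lambda>]\<close> is its sequence of coefficients: \<open>lcoef C a b n\<close> is the
  coefficient of \<open>\<lambda>\<^sup>n\<close> in the \<open>\<lambda>\<close>-product of \<open>a\<close> and \<open>b\<close>. The fields \<open>monoid.mult\<close> and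
  \<open>one\<close>, inherited from \<open>HOL-Algebra\<close>'s record of modules, play no role.\<close>

record ('k, 'a) conformal = "('k poly, 'a) module" +
  lcoef :: "'a \<Rightarrow> 'a \<Rightarrow> nat \<Rightarrow> 'a"

text \<open>The sequence of coefficients of \<open>\<lambda> p(\<lambda>)\<close>.\<close>

definition lam_times :: "('k::field_char_0, 'a) conformal \<Rightarrow> (nat \<Rightarrow> 'a) \<Rightarrow> nat \<Rightarrow> 'a" where
  "lam_times C p n = (case n of 0 \<Rightarrow> \<zero>\<^bsub>C\<^esub> | Suc m \<Rightarrow> p m)"

text \<open>The sequence of coefficients of \<open>p(-T-\<lambda>)\<close>, with \<open>T\<close> acting on the coefficients of \<open>p\<close>:
  \<open>(-T-\<lambda>)\<^sup>n\<close> is expanded as a polynomial in \<open>\<lambda>\<close> over \<open>H\<close>.\<close>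

definition subst_neg :: "('k::field_char_0, 'a) conformal \<Rightarrow> (nat \<Rightarrow> 'a) \<Rightarrow> nat \<Rightarrow> 'a" where
  "subst_neg C p m =
     (\<Oplus>\<^bsub>C\<^esub>n\<in>{n. p n \<noteq> \<zero>\<^bsub>C\<^esub>}. coeff ([:- T_H, -1:] ^ n) m \<odot>\<^bsub>C\<^esub> p n)"

text \<open>For \<open>F(\<lambda>,\<nu>) = \<Sum>\<^bsub>m,n\<^esub> \<lambda>\<^sup>m \<nu>\<^sup>n F m n\<close>, the coefficient of \<open>\<lambda>\<^sup>i \<mu>\<^sup>j\<close> in \<open>F(\<lambda>, \<lambda>+\<mu>)\<close>; since
  \<open>(\<lambda>+\<mu>)\<^sup>n\<close> contributes \<open>(n choose j) \<lambda>\<^bsup>n-j\<^esup> \<mu>\<^sup>j\<close>, only \<open>m = i + j - n\<close> matters.\<close>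

definition subst_plus ::
    "('k::field_char_0, 'a) conformal \<Rightarrow> (nat \<Rightarrow> nat \<Rightarrow> 'a) \<Rightarrow> nat \<Rightarrow> nat \<Rightarrow> 'a" where
  "subst_plus C F i j = (\<Oplus>\<^bsub>C\<^esub>n\<in>{j..i + j}. of_nat (n choose j) \<odot>\<^bsub>C\<^esub> F (i + j - n) n)"

locale lambda_algebra = Module.module H_ring C
  for C :: "('k::field_char_0, 'a) conformal" (structure) +
  assumes lcoef_closed:
      "\<lbrakk>a \<in> carrier C; b \<in> carrier C\<rbrakk> \<Longrightarrow> lcoef C a b n \<in> carrier C"
    and lcoef_finite:
      "\<lbrakk>a \<in> carrier C; b \<in> carrier C\<rbrakk> \<Longrightarrow> finite {n. lcoef C a b n \<noteq> \<zero>\<^bsub>C\<^esub>}"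
    and lcoef_add_left:
      "\<lbrakk>a \<in> carrier C; a' \<in> carrier C; b \<in> carrier C\<rbrakk> \<Longrightarrow>
        lcoef C (a \<oplus>\<^bsub>C\<^esub> a') b n = lcoef C a b n \<oplus>\<^bsub>C\<^esub> lcoef C a' b n"
    and lcoef_add_right:
      "\<lbrakk>a \<in> carrier C; b \<in> carrier C; b' \<in> carrier C\<rbrakk> \<Longrightarrow>
        lcoef C a (b \<oplus>\<^bsub>C\<^esub> b') n = lcoef C a b n \<oplus>\<^bsub>C\<^esub> lcoef C a b' n"
    and lcoef_scale_left:
      "\<lbrakk>a \<in> carrier C; b \<in> carrier C\<rbrakk> \<Longrightarrow> lcoef C ([:r:] \<odot>\<^bsub>C\<^esub> a) b n = [:r:] \<odot>\<^bsub>C\<^esub> lcoef C a b n"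
    and lcoef_scale_right:
      "\<lbrakk>a \<in> carrier C; b \<in> carrier C\<rbrakk> \<Longrightarrow> lcoef C a ([:r:] \<odot>\<^bsub>C\<^esub> b) n = [:r:] \<odot>\<^bsub>C\<^esub> lcoef C a b n"
    and lcoef_T_left:
      "\<lbrakk>a \<in> carrier C; b \<in> carrier C\<rbrakk> \<Longrightarrow>
        lcoef C (T_H \<odot>\<^bsub>C\<^esub> a) b n = \<ominus>\<^bsub>C\<^esub> lam_times C (lcoef C a b) n"
    and lcoef_T_right:
      "\<lbrakk>a \<in> carrier C; b \<in> carrier C\<rbrakk> \<Longrightarrow>
        lcoef C a (T_H \<odot>\<^bsub>C\<^esub> b) n = T_H \<odot>\<^bsub>C\<^esub> lcoef C a b n \<oplus>\<^bsub>C\<^esub> lam_times C (lcoef C a b) n"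

text \<open>In the two identities with three arguments, the indices \<open>i\<close>, \<open>j\<close> are the exponents of
  \<open>\<lambda>\<close>, \<open>\<mu>\<close>.\<close>

locale lie_conformal_algebra = lambda_algebra C
  for C :: "('k::field_char_0, 'a) conformal" (structure) +
  assumes skew_symmetry:
      "\<lbrakk>a \<in> carrier C; b \<in> carrier C\<rbrakk> \<Longrightarrow> lcoef C a b n = \<ominus>\<^bsub>C\<^esub> subst_neg C (lcoef C b a) n"
    and jacobi:
      "\<lbrakk>a \<in> carrier C; b \<in> carrier C; c \<in> carrier C\<rbrakk> \<Longrightarrow>
        subst_plus C (\<lambda>m n. lcoef C (lcoef C a b m) c n) i j =
          lcoef C a (lcoef C b c j) i \<ominus>\<^bsub>C\<^esub> lcoef C b (lcoef C a c i) j"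

locale assoc_conformal_algebra = lambda_algebra A
  for A :: "('k::field_char_0, 'a) conformal" (structure) +
  assumes associativity:
      "\<lbrakk>a \<in> carrier A; b \<in> carrier A; c \<in> carrier A\<rbrakk> \<Longrightarrow>
        subst_plus A (\<lambda>m n. lcoef A (lcoef A a b m) c n) i j = lcoef A a (lcoef A b c j) i"

definition nprod :: "('k::field_char_0, 'a) conformal \<Rightarrow> nat \<Rightarrow> 'a \<Rightarrow> 'a \<Rightarrow> 'a" where
  "nprod A n a b = fact n \<odot>\<^bsub>A\<^esub> lcoef A a b n"

definition locality :: "('k::field_char_0, 'a) conformal \<Rightarrow> 'a \<Rightarrow> 'a \<Rightarrow> nat" where
  "locality A a b = (if \<forall>n. lcoef A a b n = \<zero>\<^bsub>A\<^esub> then 0 else Max {n. lcoef A a b n \<noteq> \<zero>\<^bsub>A\<^esub>} + 1)"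

definition conformal_subalgebra :: "'a set \<Rightarrow> ('k::field_char_0, 'a) conformal \<Rightarrow> bool" where
  "conformal_subalgebra B A \<longleftrightarrow>
     submodule B H_ring A \<and> (\<forall>a\<in>B. \<forall>b\<in>B. \<forall>n. nprod A n a b \<in> B)"

definition generated_by :: "('k::field_char_0, 'a) conformal \<Rightarrow> 'a set \<Rightarrow> 'a set" where
  "generated_by A S = \<Inter>{B. conformal_subalgebra B A \<and> S \<subseteq> B}"

definition conformal_hom ::
    "('k::field_char_0, 'a) conformal \<Rightarrow> ('k, 'b) conformal \<Rightarrow> ('a \<Rightarrow> 'b) set" where
  "conformal_hom A B =
     {f. f \<in> carrier A \<rightarrow> carrier B \<and>
         (\<forall>a\<in>carrier A. \<forall>b\<in>carrier A. f (a \<oplus>\<^bsub>A\<^esub> b) = f a \<oplus>\<^bsub>B\<^esub> f b) \<and>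
         (\<forall>h. \<forall>a\<in>carrier A. f (h \<odot>\<^bsub>A\<^esub> a) = h \<odot>\<^bsub>B\<^esub> f a) \<and>
         (\<forall>a\<in>carrier A. \<forall>b\<in>carrier A. \<forall>n. f (lcoef A a b n) = lcoef B (f a) (f b) n)}"

definition conformal_iso ::
    "('k::field_char_0, 'a) conformal \<Rightarrow> ('k, 'b) conformal \<Rightarrow> ('a \<Rightarrow> 'b) set" where
  "conformal_iso A B = {f. f \<in> conformal_hom A B \<and> bij_betw f (carrier A) (carrier B)}"

text \<open>The Lie conformal algebra \<open>A\<^bsup>(-)\<^esup>\<close>.\<close>

definition commutator_algebra :: "('k::field_char_0, 'a) conformal \<Rightarrow> ('k, 'a) conformal" where
  "commutator_algebra A =
     A\<lparr>lcoef := \<lambda>a b n. lcoef A a b n \<ominus>\<^bsub>A\<^esub> subst_neg A (lcoef A b a) n\<rparr>"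


section \<open>Universal envelopes\<close>

definition assoc_envelope ::
    "('k::field_char_0, 'c) conformal \<Rightarrow> ('k, 'a) conformal \<Rightarrow> ('c \<Rightarrow> 'a) \<Rightarrow> bool" where
  "assoc_envelope C A \<tau> \<longleftrightarrow>
     lie_conformal_algebra C \<and> assoc_conformal_algebra A \<and>
     \<tau> \<in> conformal_hom C (commutator_algebra A) \<and>
     generated_by A (\<tau> ` carrier C) = carrier A"

text \<open>\<open>(U, \<tau>\<^sub>U)\<close> is universal among the envelopes of \<open>C\<close> of locality at most \<open>N\<close> on \<open>v\<close>. HOL cannot
  quantify over types in a formula, so the competing envelopes \<open>A\<close> range over all structures
  carried by subsets of the type \<open>'b\<close>. If \<open>C\<close> is generated by \<open>v\<close> as an \<open>H\<close>-module, every envelope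
  has at most countable dimension over \<open>\<k>\<close>, so this is no restriction as soon as \<open>'b\<close> has at least
  the cardinality of \<open>\<k>\<close>.\<close>

definition universal_envelope ::
    "'b itself \<Rightarrow> ('k::field_char_0, 'c) conformal \<Rightarrow> 'c \<Rightarrow> nat \<Rightarrow>
      ('k, 'u) conformal \<Rightarrow> ('c \<Rightarrow> 'u) \<Rightarrow> bool" where
  "universal_envelope _ C v N U \<tau>\<^sub>U \<longleftrightarrow>
     assoc_envelope C U \<tau>\<^sub>U \<and> locality U (\<tau>\<^sub>U v) (\<tau>\<^sub>U v) \<le> N \<and>
     (\<forall>(A :: ('k, 'b) conformal) \<tau>.
        assoc_envelope C A \<tau> \<and> locality A (\<tau> v) (\<tau> v) \<le> N \<longrightarrow>
        (\<exists>\<phi>\<in>conformal_hom U A. \<forall>c\<in>carrier C. \<tau> c = \<phi> (\<tau>\<^sub>U c)))"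


section \<open>The Virasoro Lie conformal algebra\<close>

text \<open>\<open>f v\<close> is represented by \<open>f\<close>, so that the generator \<open>v\<close> is \<open>1\<close>. Type \<open>'k poly poly\<close> is
  \<open>\<k>[T][\<lambda>]\<close> here, and \<open>f\<close>, \<open>g\<close> are evaluated in it at \<open>-\<lambda>\<close> and \<open>T+\<lambda>\<close>: by the axioms for \<open>T\<close>, the
  bracket of \<open>f v\<close> and \<open>g v\<close> is \<open>f(-\<lambda>) g(T+\<lambda>) (T+2\<lambda>) v\<close>.\<close>

definition Vir_bracket :: "'k::field_char_0 poly \<Rightarrow> 'k poly \<Rightarrow> 'k poly poly" where
  "Vir_bracket f g =
     poly (map_poly (\<lambda>c. [:[:c:]:]) f) (- [:0, 1:]) *
     poly (map_poly (\<lambda>c. [:[:c:]:]) g) ([:T_H:] + [:0, 1:]) *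
     ([:T_H:] + 2 * [:0, 1:])"

definition Vir :: "('k::field_char_0, 'k poly) conformal" where
  "Vir = \<lparr>carrier = UNIV, monoid.mult = undefined, one = undefined, ring.zero = 0, add = (+),
          module.smult = (*), lcoef = \<lambda>f g. coeff (Vir_bracket f g)\<rparr>"

lemma Vir_bracket_generator: "Vir_bracket 1 1 = [:T_H, 2:]"
  by (simp add: Vir_bracket_def numeral_poly flip: one_pCons)


section \<open>The algebra \<open>Cend\<^sub>f\<^sub>i\<^sub>n(H \<otimes> P)\<close> for \<open>P = \<k>[v]\<close>\<close>

text \<open>\<open>\<k>[T,x] \<otimes> End P\<close> is identified with the polynomials in \<open>T\<close>, \<open>x\<close> over \<open>End P\<close>: \<open>a i j\<close> is
  the coefficient of \<open>T\<^sup>i x\<^sup>j\<close>, and all but finitely many coefficients vanish.\<close>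

type_synonym 'k cend = "nat \<Rightarrow> nat \<Rightarrow> 'k poly \<Rightarrow> 'k poly"

definition cend_supp :: "'k::field_char_0 cend \<Rightarrow> (nat \<times> nat) set" where
  "cend_supp a = {(i, j). a i j \<noteq> (\<lambda>u. 0)}"

text \<open>The pure tensor \<open>f \<otimes> \<alpha>\<close>, for \<open>f\<close> in \<open>\<k>[x][T]\<close>.\<close>

definition cend_tensor :: "'k::field_char_0 poly poly \<Rightarrow> ('k poly \<Rightarrow> 'k poly) \<Rightarrow> 'k cend" where
  "cend_tensor f \<alpha> = (\<lambda>i j u. Polynomial.smult (coeff (coeff f i) j) (\<alpha> u))"

text \<open>\<open>(-\<lambda>)\<^sup>i x\<^sup>j (T+\<lambda>)\<^sup>k (x+\<lambda>)\<^sup>l\<close> as an element of \<open>\<k>[x][T][\<lambda>]\<close>.\<close>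

definition cend_monomial :: "nat \<Rightarrow> nat \<Rightarrow> nat \<Rightarrow> nat \<Rightarrow> 'k::field_char_0 poly poly poly" where
  "cend_monomial i j k l =
     (let L = [:0, 1:]; T = [:[:0, 1:]:]; X = [:[:[:0, 1:]:]:]
      in (- L) ^ i * X ^ j * (T + L) ^ k * (X + L) ^ l)"

text \<open>The \<open>\<lambda>\<close>-product of \<open>T\<^sup>i x\<^sup>j \<otimes> \<alpha>\<close> and \<open>T\<^sup>k x\<^sup>l \<otimes> \<beta>\<close> is
  \<open>(-\<lambda>)\<^sup>i x\<^sup>j (T+\<lambda>)\<^sup>k (x+\<lambda>)\<^sup>l \<otimes> \<alpha> \<beta>\<close>, extended bilinearly.\<close>

definition cend_lcoef :: "'k::field_char_0 cend \<Rightarrow> 'k cend \<Rightarrow> nat \<Rightarrow> 'k cend" where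
  "cend_lcoef a b n = (\<lambda>p q u.
     \<Sum>(i, j)\<in>cend_supp a. \<Sum>(k, l)\<in>cend_supp b.
       cend_tensor (coeff (cend_monomial i j k l) n) (a i j \<circ> b k l) p q u)"

definition Cend_fin :: "('k::field_char_0, 'k cend) conformal" where
  "Cend_fin =
     \<lparr>carrier = {a. finite (cend_supp a) \<and>
        (\<forall>i j. Vector_Spaces.linear Polynomial.smult Polynomial.smult (a i j))},
      monoid.mult = undefined, one = undefined,
      ring.zero = (\<lambda>i j u. 0), add = (\<lambda>a b i j u. a i j u + b i j u),
      module.smult = (\<lambda>h a i j u. \<Sum>r\<le>i. Polynomial.smult (coeff h r) (a (i - r) j u)),
      lcoef = cend_lcoef\<rparr>"

text \<open>\<open>x \<otimes> id - T \<otimes> (d + id) L\<^sub>v\<close>, where \<open>d = pderiv\<close> and the indeterminate \<open>v\<close> of \<open>P\<close> is \<open>[:0, 1:]\<close>.\<close>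

definition tau_v :: "'k::field_char_0 cend" where
  "tau_v = (\<lambda>i j u.
     cend_tensor [:[:0, 1:]:] id i j u -
     cend_tensor [:0, 1:] ((\<lambda>w. pderiv w + id w) \<circ> (\<lambda>w. [:0, 1:] * w)) i j u)"

definition A_V :: "('k::field_char_0, 'k cend) conformal" where
  "A_V = Cend_fin\<lparr>carrier := generated_by Cend_fin {tau_v}\<rparr>"

end

theory Submission
  imports Defs
begin

text \<open>
  Once \<open>A(V)\<close> is known to be an envelope of \<open>Vir\<close> of locality at most \<open>3\<close>, the universal property
  of \<open>U\<close> yields a homomorphism \<open>\<phi>\<close> from \<open>U\<close> to \<open>A(V)\<close>; it is onto, because its image is a subalgebra
  that contains \<open>\<tau>(v)\<close>. The point is that \<open>\<phi>\<close> is injective. For this, words in the generator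
  are found that span \<open>U\<close> over \<open>H\<close> and have \<open>H\<close>-independent images in \<open>A(V)\<close>.

  \<^emph>\<open>The words span.\<close> Let \<open>w\<close> be the image of \<open>v\<close> in an envelope of locality at most \<open>3\<close>, let \<open>L\<^sub>n\<close> be the
  coefficient of \<open>\<lambda>\<^sup>n\<close> in the left multiplication by \<open>w\<close>, and write
  \<open>(w \<^sub>\<lambda> w) = p\<^sub>0 + \<lambda> p\<^sub>1 + \<lambda>\<^sup>2 p\<^sub>2\<close>. The commutator relation of \<open>Vir\<close> says exactly that
  \<open>p\<^sub>1 = w + T p\<^sub>2\<close>. Associativity expresses every \<open>L\<^sub>i L\<^sub>j\<close> through the coefficients of the left
  multiplications by \<open>p\<^sub>0\<close>, \<open>p\<^sub>1\<close>, \<open>p\<^sub>2\<close>; comparing \<open>L\<^sub>i L\<^sub>j\<close> with \<open>L\<^sub>j L\<^sub>i\<close> gives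
  \<open>L\<^sub>n\<^sub>+\<^sub>1 L\<^sub>0 = L\<^sub>0 L\<^sub>n\<^sub>+\<^sub>1 + L\<^sub>n\<close>, the invariance of the kernel of \<open>L\<^sub>n\<close> under \<open>L\<^sub>1\<close> for \<open>n \<ge> 2\<close>, and,
  together with locality, \<open>L\<^sub>n p\<^sub>2 = 0\<close> for \<open>n \<ge> 2\<close>. Hence the \<open>H\<close>-span of the words \<open>L\<^sub>0\<^sup>n w\<close> and \<open>L\<^sub>0\<^sup>n L\<^sub>1\<^sup>k p\<^sub>2\<close> is stable under
  all \<open>L\<^sub>n\<close> (\<open>L_hspan\<close>), by associativity it is then stable under all products, and so it is the whole
  algebra (\<open>carrier_eq_hspan\<close>).

  \<^emph>\<open>The images are independent.\<close> Put \<open>D = (d + id) L\<^sub>v\<close>, so that \<open>\<tau>(v) = x - T D\<close> involves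
  \<open>End P\<close> only through \<open>D\<close>. The words go to \<open>x\<^sup>n (x - T D)\<close> and \<open>x\<^sup>n D\<^sup>k (D - D\<^sup>2)\<close>
  (\<open>ev_hom_word\<close>). For every scalar \<open>z\<close> there is a linear functional on \<open>P\<close> that turns \<open>D\<close> into
  the multiplication by \<open>z\<close> (\<open>weight_form_weight_op\<close>); in this way \<open>D\<close> becomes an indeterminate, and
  \<open>x\<^sup>n (x - T z)\<close>, \<open>x\<^sup>n z\<^sup>k (z - z\<^sup>2)\<close> are independent over \<open>H\<close>: putting \<open>z = 0\<close> isolates the first
  family (\<open>words_independent\<close>). Since \<open>x - T z\<close> is the action of \<open>v\<close> on the rank one module of
  conformal weight \<open>z\<close>, this says that \<open>A(V)\<close> collects these modules for all weights at once.

  \<^emph>\<open>Computing in \<open>Cend_fin\<close>.\<close> The field is infinite, so an element is determined by its values at scalars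
  \<open>T = s\<close>, \<open>x = y\<close>, and a \<open>\<lambda>\<close>-product by its values at scalars \<open>\<lambda> = z\<close>. In terms of values
  the product is \<open>a(-z, y) b(s + z, y + z)\<close> (\<open>genfun_cend_lcoef\<close>), and the axioms, including
  associativity, become immediate.
\<close>

section \<open>Subalgebras and homomorphisms of conformal algebras\<close>
context lambda_algebra
begin

lemma carrier_H_ring [simp]: "h \<in> carrier H_ring"
  by (simp add: H_ring_def)

lemma scalar_closed [simp, intro]: "x \<in> carrier C \<Longrightarrow> h \<odot> x \<in> carrier C"
  by (rule smult_closed) simp_all

lemma scalar_add: "x \<in> carrier C \<Longrightarrow> (g + h) \<odot> x = g \<odot> x \<oplus> h \<odot> x"
  using smult_l_distr[of g h x] by (simp add: H_ring_def)

lemma scalar_mult: "x \<in> carrier C \<Longrightarrow> (g * h) \<odot> x = g \<odot> (h \<odot> x)"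
  using smult_assoc1[of g h x] by (simp add: H_ring_def)

lemma scalar_zero [simp]: "x \<in> carrier C \<Longrightarrow> 0 \<odot> x = \<zero>"
  using smult_l_null[of x] by (simp add: H_ring_def)

lemma scalar_one [simp]: "x \<in> carrier C \<Longrightarrow> 1 \<odot> x = x"
  using smult_one[of x] by (simp add: H_ring_def)

lemma scalar_right_zero [simp]: "h \<odot> \<zero> = \<zero>"
  using smult_r_null[of h] by simp

lemma scalar_right_add:
  "\<lbrakk>x \<in> carrier C; y \<in> carrier C\<rbrakk> \<Longrightarrow> h \<odot> (x \<oplus> y) = h \<odot> x \<oplus> h \<odot> y"
  by (rule smult_r_distr) simp_all

lemma minus_eq_scalar: "x \<in> carrier C \<Longrightarrow> \<ominus> x = (- 1) \<odot> x"
  using scalar_add[of x "- 1" 1] by (intro M.minus_equality) auto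

lemma scalar_right_minus: "x \<in> carrier C \<Longrightarrow> h \<odot> (\<ominus> x) = \<ominus> (h \<odot> x)"
  by (rule smult_r_minus) simp_all

lemma scalar_uminus: "x \<in> carrier C \<Longrightarrow> (- h) \<odot> x = \<ominus> (h \<odot> x)"
  using scalar_mult[of x "- 1" h] by (simp add: minus_eq_scalar)

lemma lcoef_zero_left [simp]: "b \<in> carrier C \<Longrightarrow> lcoef C \<zero> b n = \<zero>"
  using lcoef_scale_left[of \<zero> b 0 n] by (simp add: lcoef_closed)

lemma lcoef_zero_right [simp]: "a \<in> carrier C \<Longrightarrow> lcoef C a \<zero> n = \<zero>"
  using lcoef_scale_right[of a \<zero> 0 n] by (simp add: lcoef_closed)

lemma fact_scalar: "fact n = [:fact n :: 'k:]"
  by (metis of_nat_fact of_nat_poly)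

lemma lcoef_eq_nprod:
  assumes "a \<in> carrier C" "b \<in> carrier C"
  shows "lcoef C a b n = [:inverse (fact n):] \<odot> nprod C n a b"
  unfolding nprod_def
  using assms by (simp add: fact_scalar lcoef_closed flip: scalar_mult one_pCons)

lemma conformal_subalgebraI:
  assumes sub: "B \<subseteq> carrier C" and zero: "\<zero> \<in> B"
    and add: "\<And>a b. \<lbrakk>a \<in> B; b \<in> B\<rbrakk> \<Longrightarrow> a \<oplus> b \<in> B"
    and scale: "\<And>h a. a \<in> B \<Longrightarrow> h \<odot> a \<in> B"
    and prod: "\<And>a b n. \<lbrakk>a \<in> B; b \<in> B\<rbrakk> \<Longrightarrow> lcoef C a b n \<in> B"
  shows "conformal_subalgebra B C"
  unfolding conformal_subalgebra_def
proof
  show "submodule B H_ring C"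
  proof (rule submoduleI)
    show "\<ominus> a \<in> B" if "a \<in> B" for a
      using that sub scale[of a "- 1"] minus_eq_scalar[of a] by auto
  qed (use assms in auto)
  show "\<forall>a\<in>B. \<forall>b\<in>B. \<forall>n. nprod C n a b \<in> B"
    by (simp add: nprod_def scale prod)
qed

lemma conformal_subalgebraD:
  assumes "conformal_subalgebra B C"
  shows subalgebra_subset: "B \<subseteq> carrier C" and subalgebra_zero: "\<zero> \<in> B"
    and subalgebra_add: "\<And>a b. \<lbrakk>a \<in> B; b \<in> B\<rbrakk> \<Longrightarrow> a \<oplus> b \<in> B"
    and subalgebra_scale: "\<And>h a. a \<in> B \<Longrightarrow> h \<odot> a \<in> B"
    and subalgebra_lcoef: "\<And>a b n. \<lbrakk>a \<in> B; b \<in> B\<rbrakk> \<Longrightarrow> lcoef C a b n \<in> B"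
proof -
  have sm: "submodule B H_ring C" and np: "\<forall>a\<in>B. \<forall>b\<in>B. \<forall>n. nprod C n a b \<in> B"
    using assms by (auto simp: conformal_subalgebra_def)
  note E = submoduleE[OF sm]
  show "B \<subseteq> carrier C" by (fact E)
  show "a \<oplus> b \<in> B" if "a \<in> B" "b \<in> B" for a b by (rule E(5)) fact+
  show sc: "h \<odot> a \<in> B" if "a \<in> B" for h a by (rule E(4)) (use that in auto)
  show "\<zero> \<in> B" using E(1,2) sc[of _ 0] by fastforce
  show "lcoef C a b n \<in> B" if "a \<in> B" "b \<in> B" for a b n
  proof -
    have "a \<in> carrier C" "b \<in> carrier C" using that E(1) by auto
    then show ?thesis using sc np that by (simp add: lcoef_eq_nprod)
  qed
qed

lemma carrier_subalgebra: "conformal_subalgebra (carrier C) C"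
  by (rule conformal_subalgebraI) (auto intro: lcoef_closed)

lemma generated_by_subalgebra:
  assumes "S \<subseteq> carrier C"
  shows "conformal_subalgebra (generated_by C S) C"
proof (rule conformal_subalgebraI)
  show "generated_by C S \<subseteq> carrier C"
    using assms carrier_subalgebra by (auto simp: generated_by_def)
qed (auto simp: generated_by_def subalgebra_zero subalgebra_add subalgebra_scale subalgebra_lcoef)

lemma finsum_mem_subalgebra:
  assumes B: "conformal_subalgebra B C" and f: "f \<in> A \<rightarrow> B"
  shows "finsum C f A \<in> B"
proof (cases "finite A")
  case True
  then show ?thesis using f
  proof (induction rule: finite_induct)
    case empty then show ?case by (simp add: subalgebra_zero[OF B])
  next
    case (insert x F)
    moreover have "f \<in> F \<rightarrow> carrier C" "f x \<in> carrier C"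
      using insert subalgebra_subset[OF B] by auto
    ultimately show ?case by (auto intro: subalgebra_add[OF B])
  qed
qed (simp add: subalgebra_zero[OF B] finsum_infinite)

lemma finsum_subalgebra:
  assumes B: "conformal_subalgebra B C" and f: "f \<in> A \<rightarrow> B"
  shows "finsum (C\<lparr>carrier := B\<rparr>) f A = finsum C f A"
proof -
  have "Module.module H_ring (C\<lparr>carrier := B\<rparr>)"
    using B by (simp add: conformal_subalgebra_def submodule.submodule_is_module module_axioms)
  then interpret S: Module.module H_ring "C\<lparr>carrier := B\<rparr>" .
  show ?thesis
  proof (cases "finite A")
    case True
    then show ?thesis using f
    proof (induction rule: finite_induct)
      case empty
      show ?case by (simp only: S.finsum_empty finsum_empty) simp
    next
      case (insert x F)
      moreover have "f \<in> F \<rightarrow> carrier C" "f x \<in> carrier C"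
        using insert subalgebra_subset[OF B] by auto
      moreover have "f \<in> F \<rightarrow> carrier (C\<lparr>carrier := B\<rparr>)" "f x \<in> carrier (C\<lparr>carrier := B\<rparr>)"
        using insert by auto
      ultimately show ?case using S.finsum_insert[of F x f] by auto
    qed
  qed (simp add: S.finsum_infinite finsum_infinite)
qed

lemma minus_subalgebra:
  assumes B: "conformal_subalgebra B C" and x: "x \<in> B"
  shows "\<ominus>\<^bsub>C\<lparr>carrier := B\<rparr>\<^esub> x = \<ominus> x"
proof -
  have "Module.module H_ring (C\<lparr>carrier := B\<rparr>)"
    using B by (simp add: conformal_subalgebra_def submodule.submodule_is_module module_axioms)
  then interpret S: Module.module H_ring "C\<lparr>carrier := B\<rparr>" .
  have xC: "x \<in> carrier C" using x subalgebra_subset[OF B] by auto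
  then have "\<ominus> x \<in> B" using subalgebra_scale[OF B x, of "- 1"] by (simp add: minus_eq_scalar)
  then show ?thesis using x xC M.l_neg by (intro S.minus_equality) auto
qed

lemma minus_minus_subalgebra:
  assumes B: "conformal_subalgebra B C" and x: "y \<in> B"
  shows "x \<ominus>\<^bsub>C\<lparr>carrier := B\<rparr>\<^esub> y = x \<ominus> y"
  using minus_subalgebra[OF assms] by (simp add: a_minus_def)

lemma lambda_subalgebra:
  assumes B: "conformal_subalgebra B C"
  shows "lambda_algebra (C\<lparr>carrier := B\<rparr>)"
proof -
  have "Module.module H_ring (C\<lparr>carrier := B\<rparr>)"
    using B by (simp add: conformal_subalgebra_def submodule.submodule_is_module module_axioms)
  moreover have sub: "a \<in> B \<Longrightarrow> a \<in> carrier C" for a using subalgebra_subset[OF B] by auto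
  moreover have lam: "lam_times (C\<lparr>carrier := B\<rparr>) = lam_times C"
    by (simp add: lam_times_def fun_eq_iff split: nat.splits)
  moreover have "lam_times C (lcoef C a b) n \<in> B" if "a \<in> B" "b \<in> B" for a b n
    by (auto simp: lam_times_def that subalgebra_lcoef[OF B] subalgebra_zero[OF B] split: nat.splits)
  ultimately show ?thesis
    by (intro lambda_algebra.intro lambda_algebra_axioms.intro)
      (simp_all add: subalgebra_lcoef[OF B] lcoef_finite lcoef_add_left lcoef_add_right
        lcoef_scale_left lcoef_scale_right lcoef_T_left lcoef_T_right minus_subalgebra[OF B])
qed

lemma subalgebra_of_subalgebra:
  assumes B: "conformal_subalgebra B C" and D: "conformal_subalgebra D (C\<lparr>carrier := B\<rparr>)"
  shows "conformal_subalgebra D C"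
proof -
  interpret S: lambda_algebra "C\<lparr>carrier := B\<rparr>" by (rule lambda_subalgebra[OF B])
  show ?thesis
    using S.subalgebra_subset[OF D] S.subalgebra_zero[OF D] S.subalgebra_add[OF D]
      S.subalgebra_scale[OF D] S.subalgebra_lcoef[OF D] subalgebra_subset[OF B]
    by (intro conformal_subalgebraI) auto
qed

lemma subst_neg_subalgebra:
  assumes B: "conformal_subalgebra B C" and p: "\<And>n. p n \<in> B"
  shows "subst_neg (C\<lparr>carrier := B\<rparr>) p = subst_neg C p"
  by (auto simp: subst_neg_def p subalgebra_scale[OF B] intro!: ext finsum_subalgebra[OF B])

end

lemma (in assoc_conformal_algebra) assoc_subalgebra:
  assumes B: "conformal_subalgebra B A"
  shows "assoc_conformal_algebra (A\<lparr>carrier := B\<rparr>)"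
proof -
  have sub: "a \<in> B \<Longrightarrow> a \<in> carrier A" for a using subalgebra_subset[OF B] by auto
  have "subst_plus (A\<lparr>carrier := B\<rparr>) (\<lambda>m n. lcoef A (lcoef A a b m) c n) i j =
      subst_plus A (\<lambda>m n. lcoef A (lcoef A a b m) c n) i j"
    if "a \<in> B" "b \<in> B" "c \<in> B" for a b c i j
    by (auto simp: subst_plus_def that subalgebra_scale[OF B] subalgebra_lcoef[OF B]
        intro!: finsum_subalgebra[OF B])
  then show ?thesis
    using lambda_subalgebra[OF B] associativity sub
    by (intro assoc_conformal_algebra.intro assoc_conformal_algebra_axioms.intro) auto
qed

lemma conformal_homD:
  assumes "f \<in> conformal_hom A B"
  shows hom_closed: "a \<in> carrier A \<Longrightarrow> f a \<in> carrier B"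
    and hom_add: "\<lbrakk>a \<in> carrier A; b \<in> carrier A\<rbrakk> \<Longrightarrow> f (a \<oplus>\<^bsub>A\<^esub> b) = f a \<oplus>\<^bsub>B\<^esub> f b"
    and hom_scale: "a \<in> carrier A \<Longrightarrow> f (h \<odot>\<^bsub>A\<^esub> a) = h \<odot>\<^bsub>B\<^esub> f a"
    and hom_lcoef: "\<lbrakk>a \<in> carrier A; b \<in> carrier A\<rbrakk> \<Longrightarrow> f (lcoef A a b n) = lcoef B (f a) (f b) n"
  using assms by (auto simp: conformal_hom_def)

lemma hom_image_subalgebra:
  assumes A: "lambda_algebra A" and B: "lambda_algebra B" and f: "f \<in> conformal_hom A B"
  shows "conformal_subalgebra (f ` carrier A) B"
proof -
  interpret A: lambda_algebra A by fact
  interpret B: lambda_algebra B by fact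
  note h = hom_add[OF f] hom_scale[OF f] hom_lcoef[OF f]
  show ?thesis
  proof (rule B.conformal_subalgebraI)
    have "f \<zero>\<^bsub>A\<^esub> = \<zero>\<^bsub>B\<^esub>"
      using h(2)[of "\<zero>\<^bsub>A\<^esub>" 0] hom_closed[OF f] by simp
    then show "\<zero>\<^bsub>B\<^esub> \<in> f ` carrier A" by (metis A.zero_closed imageI)
  qed (auto simp: hom_closed[OF f] A.lcoef_closed simp flip: h)
qed

lemma conformal_iso_inverse:
  assumes A: "lambda_algebra A" and B: "lambda_algebra B" and f: "f \<in> conformal_iso A B"
  shows "inv_into (carrier A) f \<in> conformal_iso B A"
proof -
  interpret A: lambda_algebra A by fact
  let ?g = "inv_into (carrier A) f"
  have f: "f \<in> conformal_hom A B" and bij: "bij_betw f (carrier A) (carrier B)"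
    using f by (auto simp: conformal_iso_def)
  have gc: "?g y \<in> carrier A" and fg: "f (?g y) = y" if "y \<in> carrier B" for y
    using that bij by (auto simp: bij_betw_def inv_into_into f_inv_into_f)
  have eq: "?g y = x" if "x \<in> carrier A" "f x = y" for x y
    using that bij by (auto simp: bij_betw_def)
  have "?g \<in> conformal_hom B A"
    unfolding conformal_hom_def
    by (auto simp: gc fg hom_add[OF f] hom_scale[OF f] hom_lcoef[OF f] A.lcoef_closed intro!: eq)
  then show ?thesis
    using bij bij_betw_inv_into by (auto simp: conformal_iso_def)
qed


section \<open>Generating functions with values in \<open>P\<close>\<close>
abbreviation pscale :: "'k::field_char_0 \<Rightarrow> 'k poly \<Rightarrow> 'k poly" (infixr \<open>\<cdot>\<close> 75) where
  "c \<cdot> u \<equiv> Polynomial.smult c u"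

text \<open>The sequence \<open>p\<close> is eventually zero and \<open>g\<close> is the polynomial function
  \<open>z \<mapsto> \<Sum>\<^sub>n z\<^sup>n p\<^sub>n\<close>. It is a relation, and not an operator on sequences, so that identities between
  coefficients can be read off from closed forms of \<open>g\<close>, with finiteness of the support carried along.\<close>
definition genfun :: "(nat \<Rightarrow> 'k::field_char_0 poly) \<Rightarrow> ('k \<Rightarrow> 'k poly) \<Rightarrow> bool" where
  "genfun p g \<longleftrightarrow> (\<exists>N. (\<forall>n\<ge>N. p n = 0) \<and> (\<forall>z. g z = (\<Sum>n<N. z ^ n \<cdot> p n)))"

lemma smult_sum_right: "c \<cdot> (\<Sum>i\<in>I. f i) = (\<Sum>i\<in>I. c \<cdot> f i)"
  by (induction I rule: infinite_finite_induct) (auto simp: smult_add_right)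

lemma smult_sum_left: "(\<Sum>i\<in>I. f i) \<cdot> u = (\<Sum>i\<in>I. f i \<cdot> u)"
  by (induction I rule: infinite_finite_induct) (auto simp: smult_add_left)

lemma genfun_eq_sum:
  assumes "genfun p g" and "\<And>n. n \<ge> M \<Longrightarrow> p n = 0"
  shows "g z = (\<Sum>n<M. z ^ n \<cdot> p n)"
proof -
  obtain N where N: "\<And>n. n \<ge> N \<Longrightarrow> p n = 0" and g: "g z = (\<Sum>n<N. z ^ n \<cdot> p n)"
    using assms(1) by (auto simp: genfun_def)
  have "(\<Sum>n<N. z ^ n \<cdot> p n) = (\<Sum>n<max M N. z ^ n \<cdot> p n)"
    by (rule sum.mono_neutral_left) (auto simp: N)
  also have "\<dots> = (\<Sum>n<M. z ^ n \<cdot> p n)"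
    by (rule sum.mono_neutral_right) (auto simp: assms(2))
  finally show ?thesis using g by simp
qed

text \<open>Each coefficient of \<open>\<Sum>\<^sub>n z\<^sup>n p\<^sub>n\<close>, as an element of \<open>P\<close>, is a scalar polynomial in \<open>z\<close> which
  vanishes on the whole of an infinite field.\<close>
lemma genfun_zero_imp:
  assumes "genfun p (\<lambda>z. 0)"
  shows "p n = 0"
proof -
  obtain N where N: "\<And>n. n \<ge> N \<Longrightarrow> p n = 0" and g: "\<And>z. 0 = (\<Sum>n<N. z ^ n \<cdot> p n)"
    using assms by (auto simp: genfun_def)
  show ?thesis
  proof (rule poly_eqI)
    fix r
    define q where "q = (\<Sum>n<N. monom (coeff (p n) r) n)"
    have "poly q z = 0" for z
      using arg_cong[OF g[of z], of "\<lambda>u. coeff u r"]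
      by (simp add: q_def poly_sum poly_monom coeff_sum mult.commute)
    then have "q = 0" by (intro iffD1[OF poly_all_0_iff_0] allI)
    then have "coeff q n = 0" by simp
    then show "coeff (p n) r = coeff 0 r"
      by (cases "n < N") (simp_all add: q_def coeff_sum coeff_monom N)
  qed
qed

lemma genfun_add:
  assumes "genfun p g" "genfun q h"
  shows "genfun (\<lambda>n. p n + q n) (\<lambda>z. g z + h z)"
proof -
  obtain N M where N: "\<And>n. n \<ge> N \<Longrightarrow> p n = 0" "\<And>n. n \<ge> M \<Longrightarrow> q n = 0"
    using assms by (auto simp: genfun_def)
  have "g z = (\<Sum>n<max N M. z ^ n \<cdot> p n)" "h z = (\<Sum>n<max N M. z ^ n \<cdot> q n)" for z
    using genfun_eq_sum[OF assms(1)] genfun_eq_sum[OF assms(2)] N by auto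
  then show ?thesis unfolding genfun_def using N
    by (intro exI[of _ "max N M"]) (auto simp: smult_add_right sum.distrib)
qed

lemma genfun_linear:
  assumes "genfun p g" and add: "\<And>u v. L (u + v) = L u + L v" and scale: "\<And>c u. L (c \<cdot> u) = c \<cdot> L u"
  shows "genfun (\<lambda>n. L (p n)) (\<lambda>z. L (g z))"
proof -
  have 0: "L 0 = 0" using scale[of 0 0] by simp
  have s: "L (\<Sum>i\<in>I. f i) = (\<Sum>i\<in>I. L (f i))" for f and I :: "nat set"
    by (induction I rule: infinite_finite_induct) (auto simp: 0 add)
  obtain N where "\<And>n. n \<ge> N \<Longrightarrow> p n = 0" and "\<And>z. g z = (\<Sum>n<N. z ^ n \<cdot> p n)"
    using assms(1) by (auto simp: genfun_def)
  then show ?thesis unfolding genfun_def by (intro exI[of _ N]) (auto simp: s scale 0)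
qed

lemma genfun_scale: "genfun p g \<Longrightarrow> genfun (\<lambda>n. c \<cdot> p n) (\<lambda>z. c \<cdot> g z)"
  by (rule genfun_linear) (auto simp: smult_add_right mult.commute)

lemma genfun_minus: "genfun p g \<Longrightarrow> genfun (\<lambda>n. - p n) (\<lambda>z. - g z)"
  by (rule genfun_linear) auto

lemma genfun_diff:
  "\<lbrakk>genfun p g; genfun q h\<rbrakk> \<Longrightarrow> genfun (\<lambda>n. p n - q n) (\<lambda>z. g z - h z)"
  using genfun_add[OF _ genfun_minus, of p g q h] by simp

lemma genfun_unique:
  assumes "genfun p g" "genfun q g"
  shows "p n = q n"
  using genfun_zero_imp[of "\<lambda>n. p n - q n" n] genfun_diff[OF assms] by simp

lemma genfun_eq: 
  assumes "genfun p g" "genfun q h" "\<And>z. g z = h z"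
  shows "p n = q n"
proof -
  have "g = h" using assms(3) by auto
  with assms show ?thesis using genfun_unique by blast
qed

lemma genfun_sum:
  assumes "\<And>i. i \<in> I \<Longrightarrow> genfun (p i) (g i)"
  shows "genfun (\<lambda>n. \<Sum>i\<in>I. p i n) (\<lambda>z. \<Sum>i\<in>I. g i z)"
  using assms
proof (induction I rule: infinite_finite_induct)
  case (insert x F)
  then show ?case by (auto intro!: genfun_add)
qed (auto simp: genfun_def)

lemma genfun_shift:
  assumes "genfun p g"
  shows "genfun (case_nat 0 p) (\<lambda>z. z \<cdot> g z)"
proof -
  obtain N where N: "\<And>n. n \<ge> N \<Longrightarrow> p n = 0" and g: "\<And>z. g z = (\<Sum>n<N. z ^ n \<cdot> p n)"
    using assms by (auto simp: genfun_def)
  have "z \<cdot> g z = (\<Sum>n<Suc N. z ^ n \<cdot> case_nat 0 p n)" for z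
    unfolding sum.lessThan_Suc_shift by (simp add: g smult_sum_right)
  moreover have "\<forall>n\<ge>Suc N. case_nat 0 p n = 0"
    by (auto simp: N split: nat.splits)
  ultimately show ?thesis unfolding genfun_def by blast
qed

lemma genfun_poly: "genfun (\<lambda>n. poly (coeff q n) s \<cdot> u) (\<lambda>z. poly (poly q [:z:]) s \<cdot> u)"
  unfolding genfun_def
proof (intro exI[of _ "Suc (degree q)"] conjI allI impI)
  fix z
  have "poly (poly q [:z:]) s = (\<Sum>i\<le>degree q. z ^ i * poly (coeff q i) s)"
    by (subst poly_altdef) (simp add: poly_sum mult.commute)
  then show "poly (poly q [:z:]) s \<cdot> u = (\<Sum>n<Suc (degree q). z ^ n \<cdot> poly (coeff q n) s \<cdot> u)"
    by (simp add: smult_sum_left smult_add_left flip: lessThan_Suc_atMost)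
qed (simp add: coeff_eq_0)

lemma genfun_poly2:
  "genfun (\<lambda>n. poly (poly (coeff q n) [:s:]) y \<cdot> u) (\<lambda>z. poly (poly (poly q [:[:z:]:]) [:s:]) y \<cdot> u)"
  unfolding genfun_def
proof (intro exI[of _ "Suc (degree q)"] conjI allI impI)
  fix z
  have "poly (poly (poly q [:[:z:]:]) [:s:]) y = (\<Sum>i\<le>degree q. z ^ i * poly (poly (coeff q i) [:s:]) y)"
    by (subst poly_altdef) (simp add: poly_sum mult.commute)
  then show "poly (poly (poly q [:[:z:]:]) [:s:]) y \<cdot> u =
      (\<Sum>n<Suc (degree q). z ^ n \<cdot> poly (poly (coeff q n) [:s:]) y \<cdot> u)"
    by (simp add: smult_sum_left smult_add_left flip: lessThan_Suc_atMost)
qed (simp add: coeff_eq_0)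

lemma genfun_at_0:
  assumes "genfun p g"
  shows "p 0 = g 0"
proof -
  obtain N where N: "\<And>n. n \<ge> N \<Longrightarrow> p n = 0" and "g 0 = (\<Sum>n<N. 0 ^ n \<cdot> p n)"
    using assms unfolding genfun_def by blast
  then show ?thesis by (cases N) (auto simp: sum.lessThan_Suc_shift simp del: sum.lessThan_Suc)
qed

lemma genfun_quadratic:
  "genfun (\<lambda>n. if n = 0 then c0 else if n = 1 then c1 else if n = 2 then c2 else 0)
     (\<lambda>z. c0 + z \<cdot> c1 + z\<^sup>2 \<cdot> c2)"
  unfolding genfun_def by (rule exI[of _ 3]) (simp add: numeral_3_eq_3 power2_eq_square)

definition genfun2 :: "(nat \<Rightarrow> nat \<Rightarrow> 'k::field_char_0 poly) \<Rightarrow> ('k \<Rightarrow> 'k \<Rightarrow> 'k poly) \<Rightarrow> bool" where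
  "genfun2 F g \<longleftrightarrow> (\<exists>N. (\<forall>i j. i \<ge> N \<or> j \<ge> N \<longrightarrow> F i j = 0) \<and>
     (\<forall>y z. g y z = (\<Sum>i<N. \<Sum>j<N. (y ^ i * z ^ j) \<cdot> F i j)))"

lemma genfun2_unique:
  assumes "genfun2 F g" "genfun2 G g"
  shows "F i j = G i j"
proof -
  obtain N M where N: "\<And>i j. i \<ge> N \<or> j \<ge> N \<Longrightarrow> F i j = 0" "\<And>i j. i \<ge> M \<or> j \<ge> M \<Longrightarrow> G i j = 0"
    and g: "\<And>y z. g y z = (\<Sum>i<N. \<Sum>j<N. (y ^ i * z ^ j) \<cdot> F i j)"
       "\<And>y z. g y z = (\<Sum>i<M. \<Sum>j<M. (y ^ i * z ^ j) \<cdot> G i j)"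
    using assms unfolding genfun2_def by blast
  have "genfun (\<lambda>i. \<Sum>j<N. z ^ j \<cdot> F i j) (\<lambda>y. g y z)" for z
    unfolding genfun_def using N(1) g(1)
    by (intro exI[of _ N]) (auto simp: smult_sum_right)
  moreover have "genfun (\<lambda>i. \<Sum>j<M. z ^ j \<cdot> G i j) (\<lambda>y. g y z)" for z
    unfolding genfun_def using N(2) g(2)
    by (intro exI[of _ M]) (auto simp: smult_sum_right)
  ultimately have "(\<Sum>j<N. z ^ j \<cdot> F i j) = (\<Sum>j<M. z ^ j \<cdot> G i j)" for z
    by (rule genfun_unique)
  moreover have "genfun (F i) (\<lambda>z. \<Sum>j<N. z ^ j \<cdot> F i j)"
    unfolding genfun_def using N(1) by (intro exI[of _ N]) auto
  moreover have "genfun (G i) (\<lambda>z. \<Sum>j<M. z ^ j \<cdot> G i j)"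
    unfolding genfun_def using N(2) by (intro exI[of _ M]) auto
  ultimately show ?thesis by (intro genfun_eq)
qed

lemma genfun2_swap: "genfun2 F g \<Longrightarrow> genfun2 (\<lambda>i j. F j i) (\<lambda>y z. g z y)"
proof -
  assume "genfun2 F g"
  then obtain N where "\<And>i j. i \<ge> N \<or> j \<ge> N \<Longrightarrow> F i j = 0"
    and "\<And>y z. g y z = (\<Sum>i<N. \<Sum>j<N. (y ^ i * z ^ j) \<cdot> F i j)"
    unfolding genfun2_def by blast
  then show ?thesis unfolding genfun2_def
    by (intro exI[of _ N] conjI allI impI) (auto simp: mult.commute intro: sum.swap)
qed

text \<open>Every row of \<open>F\<close> may have its own degree; the bound \<open>M\<close> on the number of nonzero rows is what makes
  the degrees uniformly bounded.\<close>
lemma genfun2I: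
  assumes M: "\<And>i j. i \<ge> M \<Longrightarrow> F i j = 0" and F: "\<And>i. genfun (F i) (h i)"
    and h: "\<And>z. genfun (\<lambda>i. h i z) (\<lambda>y. g y z)"
  shows "genfun2 F g"
proof -
  have "\<exists>N. \<forall>j\<ge>N. F i j = 0" for i using F[of i] by (auto simp: genfun_def)
  then obtain B where B: "\<And>i j. j \<ge> B i \<Longrightarrow> F i j = 0" by metis
  define N where "N = M + (\<Sum>i<M. B i)"
  have BN: "B i \<le> N" if "i < M" for i
    unfolding N_def by (intro trans_le_add2 member_le_sum) (use that in auto)
  have Fz: "F i j = 0" if "i \<ge> N \<or> j \<ge> N" for i j
  proof (cases "i < M")
    case True
    then show ?thesis using that BN[of i] B[of i j] by (auto simp: N_def)
  qed (simp add: M)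
  have hs: "h i z = (\<Sum>j<N. z ^ j \<cdot> F i j)" for i z
    by (rule genfun_eq_sum[OF F]) (simp add: Fz)
  have "g y z = (\<Sum>i<N. \<Sum>j<N. (y ^ i * z ^ j) \<cdot> F i j)" for y z
    by (subst genfun_eq_sum[OF h, of N]) (simp_all add: hs Fz smult_sum_right)
  then show ?thesis unfolding genfun2_def using Fz by blast
qed

text \<open>The sum is the one that occurs in the associativity and Jacobi identities, for the
  substitution of \<open>\<lambda> + \<mu>\<close>. The reindexing is that of the binomial expansion of \<open>(y + z)\<^sup>n\<close>: the term with
  indices \<open>m\<close>, \<open>n\<close>, \<open>j\<close> contributes to \<open>y\<^sup>i z\<^sup>j\<close> with \<open>i = m + n - j\<close>.\<close>
lemma genfun2_subst_plus:
  assumes "genfun2 F g"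
  shows "genfun2 (\<lambda>i j. \<Sum>n\<in>{j..i + j}. of_nat (n choose j) \<cdot> F (i + j - n) n) (\<lambda>y z. g y (y + z))"
proof -
  obtain N where N: "\<And>i j. i \<ge> N \<or> j \<ge> N \<Longrightarrow> F i j = 0"
    and g: "\<And>y z. g y z = (\<Sum>m<N. \<Sum>n<N. (y ^ m * z ^ n) \<cdot> F m n)"
    using assms unfolding genfun2_def by blast
  let ?G = "\<lambda>i j. \<Sum>n\<in>{j..i + j}. of_nat (n choose j) \<cdot> F (i + j - n) n"
  have z: "?G i j = 0" if "i \<ge> 2 * N \<or> j \<ge> 2 * N" for i j
  proof (rule sum.neutral, intro ballI)
    fix n assume "n \<in> {j..i + j}"
    then have "i + j - n \<ge> N \<or> n \<ge> N" using that by auto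
    then show "of_nat (n choose j) \<cdot> F (i + j - n) n = 0" by (simp add: N)
  qed
  have "g y (y + z) = (\<Sum>i<2*N. \<Sum>j<2*N. (y ^ i * z ^ j) \<cdot> ?G i j)" for y z
  proof -
    let ?t = "\<lambda>m n j. (y ^ m * (of_nat (n choose j) * z ^ j * y ^ (n - j))) \<cdot> F m n"
    have "g y (y + z) = (\<Sum>m<N. \<Sum>n<N. \<Sum>j\<le>n. ?t m n j)"
      by (simp add: g add.commute[of y z] binomial_ring sum_distrib_left smult_sum_left)
    also have "\<dots> = (\<Sum>(m, n, j)\<in>Sigma {..<N} (\<lambda>m. Sigma {..<N} (\<lambda>n. {..n})). ?t m n j)"
      by (simp add: sum.Sigma)
    also have "\<dots> = (\<Sum>(i, j, n)\<in>Sigma {..<2*N} (\<lambda>i. Sigma {..<2*N} (\<lambda>j. {j..i + j})).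
        (y ^ i * z ^ j) \<cdot> of_nat (n choose j) \<cdot> F (i + j - n) n)"
    proof (rule sum.reindex_bij_witness_not_neutral[where
          i = "\<lambda>(i, j, n). (i + j - n, n, j)" and j = "\<lambda>(m, n, j). (m + n - j, j, n)"
          and S' = "{}" and T' = "{(i, j, n). (i, j, n) \<in> Sigma {..<2*N} (\<lambda>i. Sigma {..<2*N} (\<lambda>j. {j..i + j}))
              \<and> (i + j - n \<ge> N \<or> n \<ge> N)}"])
      show "finite {(i, j, n). (i, j, n) \<in> Sigma {..<2*N} (\<lambda>i. Sigma {..<2*N} (\<lambda>j. {j..i + j}))
              \<and> (i + j - n \<ge> N \<or> n \<ge> N)}"
        by (rule finite_subset[of _ "Sigma {..<2*N} (\<lambda>i. Sigma {..<2*N} (\<lambda>j. {j..i + j}))"]) auto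
    qed (auto simp: N power_add[symmetric] mult_ac intro!: arg_cong2[of _ _ _ _ Polynomial.smult])
    also have "\<dots> = (\<Sum>i<2*N. \<Sum>j<2*N. (y ^ i * z ^ j) \<cdot> ?G i j)"
      by (simp add: sum.Sigma smult_sum_right)
    finally show ?thesis .
  qed
  then show ?thesis unfolding genfun2_def using z by blast
qed


section \<open>The associative conformal algebra \<open>Cend_fin\<close>\<close>
lemma finite_bound:
  assumes "finite {n :: nat. P n}"
  shows "\<exists>M. \<forall>n\<ge>M. \<not> P n"
  using assms unfolding finite_nat_set_iff_bounded by (metis mem_Collect_eq not_le)

lemma linear_poly_iff:
  "Vector_Spaces.linear Polynomial.smult Polynomial.smult f \<longleftrightarrow>
     (\<forall>u v. f (u + v) = f u + f v) \<and> (\<forall>c u. f (c \<cdot> u) = c \<cdot> f u)"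
  by (auto simp: Vector_Spaces.linear_def vector_space_def module_hom_def module_hom_axioms_def
      Modules.module_def smult_add_left smult_add_right)

text \<open>The value of \<open>a(T, x)\<close> at the scalars \<open>T = s\<close>, \<open>x = y\<close>, an endomorphism of \<open>P\<close>.\<close>
definition ev :: "'k::field_char_0 cend \<Rightarrow> 'k \<Rightarrow> 'k \<Rightarrow> 'k poly \<Rightarrow> 'k poly" where
  "ev a s y u = (\<Sum>(i, j)\<in>cend_supp a. (s ^ i * y ^ j) \<cdot> a i j u)"

lemma ev_superset:
  assumes "finite F" "cend_supp a \<subseteq> F"
  shows "ev a s y u = (\<Sum>(i, j)\<in>F. (s ^ i * y ^ j) \<cdot> a i j u)"
  unfolding ev_def by (rule sum.mono_neutral_left) (use assms in \<open>auto simp: cend_supp_def\<close>)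

lemma Cend_carrier_iff:
  "a \<in> carrier Cend_fin \<longleftrightarrow> finite (cend_supp a) \<and>
     (\<forall>i j u v. a i j (u + v) = a i j u + a i j v) \<and> (\<forall>i j c u. a i j (c \<cdot> u) = c \<cdot> a i j u)"
  by (auto simp: Cend_fin_def linear_poly_iff)

lemma finite_cend_supp: "a \<in> carrier Cend_fin \<Longrightarrow> finite (cend_supp a)"
  by (simp add: Cend_carrier_iff)

lemma cend_coeff_zero: "a \<in> carrier Cend_fin \<Longrightarrow> a i j 0 = 0"
  unfolding Cend_carrier_iff by (metis smult_0_left)

lemma genfun2_ev:
  assumes "finite (cend_supp a)"
  shows "genfun2 (\<lambda>i j. a i j u) (\<lambda>s y. ev a s y u)"
proof -
  obtain N where "\<forall>p\<in>cend_supp a. fst p < N \<and> snd p < N"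
  proof
    let ?N = "Suc (\<Sum>p\<in>cend_supp a. fst p + snd p)"
    show "\<forall>p\<in>cend_supp a. fst p < ?N \<and> snd p < ?N"
      using member_le_sum[of _ "cend_supp a" "\<lambda>p. fst p + snd p"] assms by fastforce
  qed
  then have N: "cend_supp a \<subseteq> {..<N} \<times> {..<N}" by auto
  have "a i j u = 0" if "i \<ge> N \<or> j \<ge> N" for i j
  proof -
    have "(i, j) \<notin> cend_supp a" using N that by auto
    then show ?thesis by (simp add: cend_supp_def)
  qed
  moreover have "ev a s y u = (\<Sum>i<N. \<Sum>j<N. (s ^ i * y ^ j) \<cdot> a i j u)" for s y
    using ev_superset[OF _ N] by (simp add: sum.cartesian_product)
  ultimately show ?thesis unfolding genfun2_def by blast
qed

lemma ev_eqI:
  assumes "a \<in> carrier Cend_fin" "b \<in> carrier Cend_fin" "\<And>s y u. ev a s y u = ev b s y u"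
  shows "a = b"
proof (intro ext)
  fix i j u
  have "genfun2 (\<lambda>i j. a i j u) (\<lambda>s y. ev a s y u)" "genfun2 (\<lambda>i j. b i j u) (\<lambda>s y. ev a s y u)"
    using genfun2_ev[of a u] genfun2_ev[of b u] assms by (auto simp: finite_cend_supp)
  then show "a i j u = b i j u" by (rule genfun2_unique)
qed

lemma ev_vector:
  assumes "a \<in> carrier Cend_fin"
  shows ev_vector_add: "ev a s y (u + v) = ev a s y u + ev a s y v"
    and ev_vector_scale: "ev a s y (c \<cdot> u) = c \<cdot> ev a s y u"
  using assms by (auto simp: ev_def Cend_carrier_iff smult_add_right sum.distrib smult_sum_right
      mult.commute mult.left_commute split_def)

lemma cend_zero_closed: "\<zero>\<^bsub>Cend_fin\<^esub> \<in> carrier Cend_fin"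
  by (simp add: Cend_carrier_iff) (simp add: Cend_fin_def cend_supp_def)

lemma ev_zero: "ev \<zero>\<^bsub>Cend_fin\<^esub> s y u = 0"
  by (simp add: ev_def) (simp add: Cend_fin_def)

lemma cend_add_supp: "cend_supp (a \<oplus>\<^bsub>Cend_fin\<^esub> b) \<subseteq> cend_supp a \<union> cend_supp b"
  by (auto simp: Cend_fin_def cend_supp_def)

lemma cend_add_closed:
  assumes "a \<in> carrier Cend_fin" "b \<in> carrier Cend_fin"
  shows "a \<oplus>\<^bsub>Cend_fin\<^esub> b \<in> carrier Cend_fin"
proof -
  have "finite (cend_supp (a \<oplus>\<^bsub>Cend_fin\<^esub> b))"
    by (rule finite_subset[OF cend_add_supp]) (use assms in \<open>simp add: finite_cend_supp\<close>)
  then show ?thesis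
    using assms by (simp add: Cend_carrier_iff) (simp add: Cend_fin_def smult_add_right)
qed

lemma ev_add:
  assumes "a \<in> carrier Cend_fin" "b \<in> carrier Cend_fin"
  shows "ev (a \<oplus>\<^bsub>Cend_fin\<^esub> b) s y u = ev a s y u + ev b s y u"
proof -
  let ?F = "cend_supp a \<union> cend_supp b"
  have "finite ?F" using assms by (simp add: finite_cend_supp)
  moreover have "ev a s y u = (\<Sum>(i, j)\<in>?F. (s ^ i * y ^ j) \<cdot> a i j u)"
    "ev b s y u = (\<Sum>(i, j)\<in>?F. (s ^ i * y ^ j) \<cdot> b i j u)"
    using \<open>finite ?F\<close> by (auto intro: ev_superset)
  ultimately show ?thesis
    using cend_add_supp[of a b]
    by (simp add: ev_superset[of ?F "a \<oplus>\<^bsub>Cend_fin\<^esub> b"] flip: sum.distrib)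
      (simp add: Cend_fin_def smult_add_right split_def)
qed

lemma cend_const_scale:
  assumes "a \<in> carrier Cend_fin"
  shows "(\<lambda>i j u. c \<cdot> a i j u) \<in> carrier Cend_fin"
    and "ev (\<lambda>i j u. c \<cdot> a i j u) s y u = c \<cdot> ev a s y u"
proof -
  have sub: "cend_supp (\<lambda>i j u. c \<cdot> a i j u) \<subseteq> cend_supp a" by (auto simp: cend_supp_def)
  show "(\<lambda>i j u. c \<cdot> a i j u) \<in> carrier Cend_fin"
    using assms finite_subset[OF sub] by (auto simp: Cend_carrier_iff smult_add_right mult.commute)
  show "ev (\<lambda>i j u. c \<cdot> a i j u) s y u = c \<cdot> ev a s y u"
    by (subst ev_superset[OF finite_cend_supp[OF assms] sub])
      (simp add: ev_def smult_sum_right split_def mult.commute)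
qed

lemma cend_T_shift:
  assumes "a \<in> carrier Cend_fin"
  shows "(\<lambda>i j u. case i of 0 \<Rightarrow> 0 | Suc m \<Rightarrow> a m j u) \<in> carrier Cend_fin"
    and "ev (\<lambda>i j u. case i of 0 \<Rightarrow> 0 | Suc m \<Rightarrow> a m j u) s y u = s \<cdot> ev a s y u"
proof -
  let ?a = "\<lambda>i j u. case i of 0 \<Rightarrow> 0 | Suc m \<Rightarrow> a m j u"
  let ?F = "(\<lambda>(i, j). (Suc i, j)) ` cend_supp a"
  have sub: "cend_supp ?a \<subseteq> ?F" by (force simp: cend_supp_def split: nat.splits)
  have fin: "finite ?F" using assms by (simp add: finite_cend_supp)
  show "?a \<in> carrier Cend_fin"
    using assms finite_subset[OF sub fin] by (auto simp: Cend_carrier_iff split: nat.splits)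
  have "inj_on (\<lambda>(i, j). (Suc i, j)) (cend_supp a)" by (auto simp: inj_on_def)
  then show "ev ?a s y u = s \<cdot> ev a s y u"
    by (subst ev_superset[OF fin sub])
      (simp add: ev_def sum.reindex smult_sum_right split_def mult.assoc)
qed

text \<open>The convolution in the definition of the \<open>H\<close>-action is the Horner scheme for \<open>pCons c h = c + T h\<close>,
  which allows induction on \<open>h\<close>.\<close>
lemma cend_scale_pCons:
  "pCons c h \<odot>\<^bsub>Cend_fin\<^esub> a = (\<lambda>i j u. c \<cdot> a i j u) \<oplus>\<^bsub>Cend_fin\<^esub>
     (\<lambda>i j u. case i of 0 \<Rightarrow> 0 | Suc m \<Rightarrow> (h \<odot>\<^bsub>Cend_fin\<^esub> a) m j u)"
proof (intro ext)
  fix i j u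
  show "(pCons c h \<odot>\<^bsub>Cend_fin\<^esub> a) i j u = ((\<lambda>i j u. c \<cdot> a i j u) \<oplus>\<^bsub>Cend_fin\<^esub>
     (\<lambda>i j u. case i of 0 \<Rightarrow> 0 | Suc m \<Rightarrow> (h \<odot>\<^bsub>Cend_fin\<^esub> a) m j u)) i j u"
    by (cases i) (simp_all add: Cend_fin_def sum.atMost_Suc_shift del: sum.atMost_Suc)
qed

lemma cend_scale:
  assumes "a \<in> carrier Cend_fin"
  shows cend_scale_closed: "h \<odot>\<^bsub>Cend_fin\<^esub> a \<in> carrier Cend_fin"
    and ev_scale: "ev (h \<odot>\<^bsub>Cend_fin\<^esub> a) s y u = poly h s \<cdot> ev a s y u"
proof (induction h)
  case 0
  have "0 \<odot>\<^bsub>Cend_fin\<^esub> a = \<zero>\<^bsub>Cend_fin\<^esub>" by (simp add: Cend_fin_def)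
  { case 1 show ?case by (simp add: \<open>0 \<odot>\<^bsub>Cend_fin\<^esub> a = \<zero>\<^bsub>Cend_fin\<^esub>\<close> cend_zero_closed) }
  { case 2 show ?case by (simp add: \<open>0 \<odot>\<^bsub>Cend_fin\<^esub> a = \<zero>\<^bsub>Cend_fin\<^esub>\<close> ev_zero) }
next
  case (pCons c h)
  { case 1 show ?case unfolding cend_scale_pCons
      by (intro cend_add_closed cend_const_scale cend_T_shift assms pCons) }
  { case 2 show ?case unfolding cend_scale_pCons
      by (simp add: ev_add cend_const_scale cend_T_shift assms pCons smult_add_left) }
qed

lemma Cend_module: "Module.module H_ring (Cend_fin :: ('k::field_char_0, 'k cend) conformal)"
proof (rule moduleI)
  show "cring (H_ring :: 'k poly ring)"
    by unfold_locales
      (auto simp: H_ring_def Units_def algebra_simps intro: exI[of _ "- _"])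
  note closed = cend_add_closed cend_scale_closed cend_zero_closed
  show "abelian_group (Cend_fin :: ('k, 'k cend) conformal)"
  proof (rule abelian_groupI)
    show "\<exists>b\<in>carrier Cend_fin. b \<oplus>\<^bsub>Cend_fin\<^esub> a = \<zero>\<^bsub>Cend_fin\<^esub>"
      if "a \<in> carrier Cend_fin" for a :: "'k cend"
      by (rule bexI[of _ "(- 1) \<odot>\<^bsub>Cend_fin\<^esub> a"])
        (auto intro!: ev_eqI closed simp: that ev_add ev_scale ev_zero closed)
  qed (auto intro!: ev_eqI closed simp: ev_add ev_zero closed add_ac)
qed (auto intro!: ev_eqI cend_add_closed cend_scale_closed cend_zero_closed
    simp: H_ring_def ev_add ev_scale cend_add_closed cend_scale_closed smult_add_left smult_add_right)

lemma ev_finsum: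
  assumes "finite I" "f \<in> I \<rightarrow> carrier Cend_fin"
  shows "ev (finsum Cend_fin f I) s y u = (\<Sum>i\<in>I. ev (f i) s y u)"
proof -
  interpret Module.module H_ring Cend_fin by (rule Cend_module)
  from assms show ?thesis
  proof (induction I rule: finite_induct)
    case empty
    then show ?case by (simp add: ev_zero)
  next
    case (insert x F)
    moreover have "f \<in> F \<rightarrow> carrier Cend_fin" "f x \<in> carrier Cend_fin" using insert by auto
    ultimately show ?case by (simp add: ev_add)
  qed
qed

lemma ev_minus:
  assumes "a \<in> carrier Cend_fin"
  shows "ev (\<ominus>\<^bsub>Cend_fin\<^esub> a) s y u = - ev a s y u"
proof -
  interpret Module.module H_ring Cend_fin by (rule Cend_module)
  have "ev (\<ominus>\<^bsub>Cend_fin\<^esub> a \<oplus>\<^bsub>Cend_fin\<^esub> a) s y u = 0"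
    using assms by (simp add: M.l_neg ev_zero)
  then show ?thesis using assms by (simp add: ev_add eq_neg_iff_add_eq_0)
qed

lemma cend_sum:
  assumes "finite I" "\<And>x. x \<in> I \<Longrightarrow> f x \<in> carrier Cend_fin"
  shows "(\<lambda>i j u. \<Sum>x\<in>I. f x i j u) \<in> carrier Cend_fin"
    and "ev (\<lambda>i j u. \<Sum>x\<in>I. f x i j u) s y u = (\<Sum>x\<in>I. ev (f x) s y u)"
proof -
  interpret Module.module H_ring Cend_fin by (rule Cend_module)
  have *: "(\<lambda>i j u. \<Sum>x\<in>I. f x i j u) = finsum Cend_fin f I"
    using assms
  proof (induction I rule: finite_induct)
    case empty
    have "(\<lambda>i j u. 0) = \<zero>\<^bsub>Cend_fin\<^esub>" by (simp add: Cend_fin_def)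
    then show ?case by simp
  next
    case (insert x F)
    then have "finsum Cend_fin f (insert x F) = f x \<oplus>\<^bsub>Cend_fin\<^esub> finsum Cend_fin f F"
      by (intro finsum_insert) auto
    also have "\<dots> = f x \<oplus>\<^bsub>Cend_fin\<^esub> (\<lambda>i j u. \<Sum>x\<in>F. f x i j u)" using insert by simp
    finally show ?case using insert(1,2) by (simp add: Cend_fin_def)
  qed
  show "(\<lambda>i j u. \<Sum>x\<in>I. f x i j u) \<in> carrier Cend_fin"
    unfolding * using assms by (intro finsum_closed) auto
  show "ev (\<lambda>i j u. \<Sum>x\<in>I. f x i j u) s y u = (\<Sum>x\<in>I. ev (f x) s y u)"
    unfolding * using assms by (intro ev_finsum) auto
qed

lemma cend_tensor:
  assumes lin: "\<And>u v. \<alpha> (u + v) = \<alpha> u + \<alpha> v" "\<And>c u. \<alpha> (c \<cdot> u) = c \<cdot> \<alpha> u"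
  shows cend_tensor_closed: "cend_tensor f \<alpha> \<in> carrier Cend_fin"
    and ev_tensor: "ev (cend_tensor f \<alpha>) s y u = poly (poly f [:s:]) y \<cdot> \<alpha> u"
proof -
  let ?F = "Sigma {..degree f} (\<lambda>i. {..degree (coeff f i)})"
  have sub: "cend_supp (cend_tensor f \<alpha>) \<subseteq> ?F"
  proof
    fix p assume "p \<in> cend_supp (cend_tensor f \<alpha>)"
    then have "coeff (coeff f (fst p)) (snd p) \<noteq> 0"
      by (auto simp: cend_supp_def cend_tensor_def split: prod.splits)
    then have "coeff f (fst p) \<noteq> 0" "snd p \<le> degree (coeff f (fst p))"
      by (auto intro: le_degree)
    then show "p \<in> ?F" by (cases p) (auto intro: le_degree)
  qed
  have fin: "finite ?F" by auto
  show "cend_tensor f \<alpha> \<in> carrier Cend_fin"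
    using finite_subset[OF sub fin]
    by (auto simp: Cend_carrier_iff cend_tensor_def lin smult_add_right mult.commute)
  have "ev (cend_tensor f \<alpha>) s y u = (\<Sum>i\<le>degree f. \<Sum>j\<le>degree (coeff f i).
      (s ^ i * y ^ j) \<cdot> cend_tensor f \<alpha> i j u)"
    by (subst ev_superset[OF fin sub]) (simp add: sum.Sigma)
  also have "\<dots> = (\<Sum>i\<le>degree f. poly (coeff f i) y * s ^ i) \<cdot> \<alpha> u"
    by (simp add: cend_tensor_def smult_sum_left poly_altdef[of "coeff f _"] sum_distrib_left mult_ac)
  also have "(\<Sum>i\<le>degree f. poly (coeff f i) y * s ^ i) = poly (poly f [:s:]) y"
    by (simp add: poly_altdef[of f] poly_sum)
  finally show "ev (cend_tensor f \<alpha>) s y u = poly (poly f [:s:]) y \<cdot> \<alpha> u" .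
qed

lemma lcoef_Cend [simp]: "lcoef Cend_fin = cend_lcoef"
  by (simp add: Cend_fin_def)

context
  fixes a b :: "'k::field_char_0 cend"
  assumes a: "a \<in> carrier Cend_fin" and b: "b \<in> carrier Cend_fin"
begin

definition cend_term :: "nat \<Rightarrow> (nat \<times> nat) \<times> (nat \<times> nat) \<Rightarrow> 'k cend" where
  "cend_term n x = (case x of ((i, j), (k, l)) \<Rightarrow>
     cend_tensor (coeff (cend_monomial i j k l) n) (a i j \<circ> b k l))"

lemma cend_term_closed: "cend_term n x \<in> carrier Cend_fin"
  unfolding cend_term_def split_def
  by (rule cend_tensor_closed) (use a b in \<open>auto simp: Cend_carrier_iff\<close>)

lemma ev_cend_term:
  "ev (cend_term n ((i, j), (k, l))) s y u =
     poly (poly (coeff (cend_monomial i j k l) n) [:s:]) y \<cdot> a i j (b k l u)"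
  unfolding cend_term_def prod.case
  by (subst ev_tensor) (use a b in \<open>auto simp: Cend_carrier_iff\<close>)

lemma cend_lcoef_eq_sum:
  "cend_lcoef a b n = (\<lambda>p q u. \<Sum>x\<in>cend_supp a \<times> cend_supp b. cend_term n x p q u)"
  by (simp add: cend_lcoef_def cend_term_def sum.cartesian_product split_def)

lemma finite_supp_product: "finite (cend_supp a \<times> cend_supp b)"
  using a b by (simp add: finite_cend_supp)

lemma cend_lcoef_closed: "cend_lcoef a b n \<in> carrier Cend_fin"
  unfolding cend_lcoef_eq_sum
  by (rule cend_sum(1)[where f = "cend_term n"]) (rule finite_supp_product cend_term_closed)+

text \<open>Each of the finitely many pairs of monomials contributes a polynomial in \<open>\<lambda>\<close>.\<close>
lemma cend_lcoef_finite: "finite {n. cend_lcoef a b n \<noteq> \<zero>\<^bsub>Cend_fin\<^esub>}"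
proof (rule finite_subset)
  let ?d = "\<lambda>((i, j), (k, l)). degree (cend_monomial i j k l :: 'k poly poly poly)"
  let ?B = "\<Union>x\<in>cend_supp a \<times> cend_supp b. {..?d x}"
  show "finite ?B" using finite_supp_product by simp
  show "{n. cend_lcoef a b n \<noteq> \<zero>\<^bsub>Cend_fin\<^esub>} \<subseteq> ?B"
  proof (rule ccontr)
    assume "\<not> ?thesis"
    then obtain n where n: "cend_lcoef a b n \<noteq> \<zero>\<^bsub>Cend_fin\<^esub>"
      and big: "\<And>x. x \<in> cend_supp a \<times> cend_supp b \<Longrightarrow> n > ?d x" by force
    have "cend_term n x p q u = 0" if "x \<in> cend_supp a \<times> cend_supp b" for x p q u
      using big[OF that] by (auto simp: cend_term_def cend_tensor_def coeff_eq_0 split: prod.splits)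
    then have "cend_lcoef a b n = (\<lambda>p q u. 0)" by (simp add: cend_lcoef_eq_sum)
    with n show False by (simp add: Cend_fin_def)
  qed
qed

text \<open>This is the formula \<open>(a \<^sub>\<lambda> b)(T, x) = a(-\<lambda>, x) b(T + \<lambda>, x + \<lambda>)\<close> at scalars. All later
  computations in \<open>Cend_fin\<close> go through it.\<close>
lemma genfun_cend_lcoef:
  "genfun (\<lambda>n. ev (cend_lcoef a b n) s y u) (\<lambda>z. ev a (- z) y (ev b (s + z) (y + z) u))"
proof -
  have "ev (cend_lcoef a b n) s y u = (\<Sum>x\<in>cend_supp a \<times> cend_supp b. ev (cend_term n x) s y u)" for n
    unfolding cend_lcoef_eq_sum
    by (rule cend_sum(2)[where f = "cend_term n"]) (rule finite_supp_product cend_term_closed)+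
  moreover have "genfun (\<lambda>n. ev (cend_term n x) s y u) (\<lambda>z. case x of ((i, j), (k, l)) \<Rightarrow>
      ((- z) ^ i * y ^ j * (s + z) ^ k * (y + z) ^ l) \<cdot> a i j (b k l u))" for x
  proof -
    obtain i j k l where x: "x = ((i, j), (k, l))" by (metis prod.exhaust)
    show ?thesis
      using genfun_poly2[of "cend_monomial i j k l" s y "a i j (b k l u)"]
      by (simp add: x ev_cend_term) (simp add: cend_monomial_def Let_def add.commute)
  qed
  moreover have "ev a (- z) y (ev b (s + z) (y + z) u) =
     (\<Sum>x\<in>cend_supp a \<times> cend_supp b. case x of ((i, j), (k, l)) \<Rightarrow>
      ((- z) ^ i * y ^ j * (s + z) ^ k * (y + z) ^ l) \<cdot> a i j (b k l u))" for z
  proof -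
    have lin: "a i j (\<Sum>x\<in>X. c x \<cdot> f x) = (\<Sum>x\<in>X. c x \<cdot> a i j (f x))" for i j c f and X :: "(nat \<times> nat) set"
      using a cend_coeff_zero[OF a, of i j]
      by (induction X rule: infinite_finite_induct) (auto simp: Cend_carrier_iff)
    show ?thesis
      by (simp add: ev_def[of a] ev_def[of b] split_def lin smult_sum_right
          sum.cartesian_product mult_ac)
  qed
  ultimately show ?thesis
    by (simp only:) (rule genfun_sum)
qed

end


lemma ev_lam_times: "ev (lam_times Cend_fin p n) s y u = case_nat 0 (\<lambda>m. ev (p m) s y u) n"
  by (cases n) (simp_all add: lam_times_def ev_zero)

text \<open>In terms of values, both sides of associativity are
  \<open>a(-\<lambda>, y) b(-\<mu>, y + \<lambda>) c(s + \<lambda> + \<mu>, y + \<lambda> + \<mu>)\<close>.\<close>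
lemma Cend_assoc: "assoc_conformal_algebra (Cend_fin :: ('k::field_char_0, 'k cend) conformal)"
proof -
  let ?C = "Cend_fin :: ('k, 'k cend) conformal"
  interpret Module.module H_ring ?C by (rule Cend_module)
  have lam_closed: "lam_times ?C p n \<in> carrier ?C" if "\<And>m. p m \<in> carrier ?C" for p n
    using that by (cases n) (simp_all add: lam_times_def)
  note closed = cend_lcoef_closed cend_scale_closed lam_closed
  note simps = ev_add ev_scale ev_minus ev_lam_times closed
  have lambda: "lambda_algebra ?C"
  proof (intro lambda_algebra.intro lambda_algebra_axioms.intro, unfold lcoef_Cend)
    show "Module.module H_ring ?C" by (rule Cend_module)
  next
    fix a a' b :: "'k cend" and n
    assume [simp]: "a \<in> carrier ?C" "a' \<in> carrier ?C" "b \<in> carrier ?C"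
    show "cend_lcoef (a \<oplus>\<^bsub>?C\<^esub> a') b n = cend_lcoef a b n \<oplus>\<^bsub>?C\<^esub> cend_lcoef a' b n"
    proof (rule ev_eqI)
      fix s y u
      have "ev (cend_lcoef (a \<oplus>\<^bsub>?C\<^esub> a') b n) s y u = ev (cend_lcoef a b n) s y u + ev (cend_lcoef a' b n) s y u"
        by (rule genfun_eq[OF genfun_cend_lcoef genfun_add[OF genfun_cend_lcoef genfun_cend_lcoef]])
            (simp_all add: simps)
      then show "ev (cend_lcoef (a \<oplus>\<^bsub>?C\<^esub> a') b n) s y u = ev (cend_lcoef a b n \<oplus>\<^bsub>?C\<^esub> cend_lcoef a' b n) s y u"
        by (simp add: simps)
    qed (simp_all add: closed)
  next
    fix a b b' :: "'k cend" and n
    assume [simp]: "a \<in> carrier ?C" "b' \<in> carrier ?C" "b \<in> carrier ?C"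
    show "cend_lcoef a (b \<oplus>\<^bsub>?C\<^esub> b') n = cend_lcoef a b n \<oplus>\<^bsub>?C\<^esub> cend_lcoef a b' n"
    proof (rule ev_eqI)
      fix s y u
      have "ev (cend_lcoef a (b \<oplus>\<^bsub>?C\<^esub> b') n) s y u = ev (cend_lcoef a b n) s y u + ev (cend_lcoef a b' n) s y u"
        by (rule genfun_eq[OF genfun_cend_lcoef genfun_add[OF genfun_cend_lcoef genfun_cend_lcoef]])
            (simp_all add: simps ev_vector_add)
      then show "ev (cend_lcoef a (b \<oplus>\<^bsub>?C\<^esub> b') n) s y u = ev (cend_lcoef a b n \<oplus>\<^bsub>?C\<^esub> cend_lcoef a b' n) s y u"
        by (simp add: simps)
    qed (simp_all add: closed)
  next
    fix a b :: "'k cend" and n r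
    assume [simp]: "a \<in> carrier ?C" "b \<in> carrier ?C"
    show "cend_lcoef a b n \<in> carrier ?C" by (simp add: closed)
    show "finite {n. cend_lcoef a b n \<noteq> \<zero>\<^bsub>?C\<^esub>}" by (simp add: cend_lcoef_finite)
    show "cend_lcoef ([:r:] \<odot>\<^bsub>?C\<^esub> a) b n = [:r:] \<odot>\<^bsub>?C\<^esub> cend_lcoef a b n"
    proof (rule ev_eqI)
      fix s y u
      have "ev (cend_lcoef ([:r:] \<odot>\<^bsub>?C\<^esub> a) b n) s y u = r \<cdot> ev (cend_lcoef a b n) s y u"
        by (rule genfun_eq[OF genfun_cend_lcoef genfun_scale[OF genfun_cend_lcoef]]) (simp_all add: simps)
      then show "ev (cend_lcoef ([:r:] \<odot>\<^bsub>?C\<^esub> a) b n) s y u = ev ([:r:] \<odot>\<^bsub>?C\<^esub> cend_lcoef a b n) s y u"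
        by (simp add: simps)
    qed (simp_all add: closed)
    show "cend_lcoef a ([:r:] \<odot>\<^bsub>?C\<^esub> b) n = [:r:] \<odot>\<^bsub>?C\<^esub> cend_lcoef a b n"
    proof (rule ev_eqI)
      fix s y u
      have "ev (cend_lcoef a ([:r:] \<odot>\<^bsub>?C\<^esub> b) n) s y u = r \<cdot> ev (cend_lcoef a b n) s y u"
        by (rule genfun_eq[OF genfun_cend_lcoef genfun_scale[OF genfun_cend_lcoef]])
            (simp_all add: simps ev_vector_scale)
      then show "ev (cend_lcoef a ([:r:] \<odot>\<^bsub>?C\<^esub> b) n) s y u = ev ([:r:] \<odot>\<^bsub>?C\<^esub> cend_lcoef a b n) s y u"
        by (simp add: simps)
    qed (simp_all add: closed)
    show "cend_lcoef (T_H \<odot>\<^bsub>?C\<^esub> a) b n = \<ominus>\<^bsub>?C\<^esub> lam_times ?C (cend_lcoef a b) n"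
    proof (rule ev_eqI)
      fix s y u
      have "ev (cend_lcoef (T_H \<odot>\<^bsub>?C\<^esub> a) b n) s y u = - case_nat 0 (\<lambda>m. ev (cend_lcoef a b m) s y u) n"
        by (rule genfun_eq[OF genfun_cend_lcoef genfun_minus[OF genfun_shift[OF genfun_cend_lcoef]]])
            (simp_all add: simps split: nat.splits)
      then show "ev (cend_lcoef (T_H \<odot>\<^bsub>?C\<^esub> a) b n) s y u = ev (\<ominus>\<^bsub>?C\<^esub> lam_times ?C (cend_lcoef a b) n) s y u"
        by (simp add: simps)
    qed (simp_all add: closed)
    show "cend_lcoef a (T_H \<odot>\<^bsub>?C\<^esub> b) n =
        T_H \<odot>\<^bsub>?C\<^esub> cend_lcoef a b n \<oplus>\<^bsub>?C\<^esub> lam_times ?C (cend_lcoef a b) n"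
    proof (rule ev_eqI)
      fix s y u
      have "ev (cend_lcoef a (T_H \<odot>\<^bsub>?C\<^esub> b) n) s y u =
          s \<cdot> ev (cend_lcoef a b n) s y u + case_nat 0 (\<lambda>m. ev (cend_lcoef a b m) s y u) n"
        by (rule genfun_eq[OF genfun_cend_lcoef
              genfun_add[OF genfun_scale[OF genfun_cend_lcoef] genfun_shift[OF genfun_cend_lcoef]]])
            (simp_all add: simps ev_vector_add ev_vector_scale smult_add_left)
      then show "ev (cend_lcoef a (T_H \<odot>\<^bsub>?C\<^esub> b) n) s y u =
          ev (T_H \<odot>\<^bsub>?C\<^esub> cend_lcoef a b n \<oplus>\<^bsub>?C\<^esub> lam_times ?C (cend_lcoef a b) n) s y u"
        by (simp add: simps)
    qed (simp_all add: closed)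
  qed
  show ?thesis
  proof (intro assoc_conformal_algebra.intro assoc_conformal_algebra_axioms.intro lambda,
      unfold lcoef_Cend)
    fix a b c :: "'k cend" and i j
    assume [simp]: "a \<in> carrier ?C" "b \<in> carrier ?C" "c \<in> carrier ?C"
    let ?F = "\<lambda>m n. cend_lcoef (cend_lcoef a b m) c n"
    have term_closed: "(\<lambda>n. of_nat (n choose j) \<odot>\<^bsub>?C\<^esub> ?F (i + j - n) n) \<in> {j..i + j} \<rightarrow> carrier ?C" for i j
      by (auto intro!: closed)
    show "subst_plus ?C ?F i j = cend_lcoef a (cend_lcoef b c j) i"
    proof (rule ev_eqI)
      show "subst_plus ?C ?F i j \<in> carrier ?C"
        unfolding subst_plus_def by (rule M.finsum_closed[OF term_closed])
      fix s y u
      obtain M' where M': "\<And>m. m \<ge> M' \<Longrightarrow> cend_lcoef b c m = \<zero>\<^bsub>?C\<^esub>"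
        using finite_bound[OF cend_lcoef_finite[of b c]] by auto
      obtain M where M: "\<And>m. m \<ge> M \<Longrightarrow> cend_lcoef a b m = \<zero>\<^bsub>?C\<^esub>"
        using finite_bound[OF cend_lcoef_finite[of a b]] by auto
      have zero_left: "cend_lcoef \<zero>\<^bsub>?C\<^esub> c n = \<zero>\<^bsub>?C\<^esub>" for n
        using lambda_algebra.lcoef_zero_left[OF lambda, of c n] by simp
      have "genfun2 (\<lambda>m n. ev (?F m n) s y u)
          (\<lambda>x z. ev a (- x) y (ev b (x - z) (y + x) (ev c (s + z) (y + z) u)))"
      proof (rule genfun2I)
        show "ev (?F m n) s y u = 0" if "m \<ge> M" for m n
          using that by (simp add: M zero_left ev_zero)
        show "genfun (\<lambda>n. ev (?F m n) s y u) (\<lambda>z. ev (cend_lcoef a b m) (- z) y (ev c (s + z) (y + z) u))" for m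
          by (rule genfun_cend_lcoef) (simp_all add: closed)
        show "genfun (\<lambda>m. ev (cend_lcoef a b m) (- z) y (ev c (s + z) (y + z) u))
          (\<lambda>x. ev a (- x) y (ev b (x - z) (y + x) (ev c (s + z) (y + z) u)))" for z
          using genfun_cend_lcoef[of a b "- z" y] by simp
      qed
      from genfun2_subst_plus[OF this]
      have "genfun2 (\<lambda>i j. ev (subst_plus ?C ?F i j) s y u)
          (\<lambda>x z. ev a (- x) y (ev b (- z) (y + x) (ev c (s + x + z) (y + x + z) u)))"
        unfolding subst_plus_def ev_finsum[OF finite_atLeastAtMost term_closed]
        by (simp add: ev_scale closed algebra_simps)
      moreover have "genfun2 (\<lambda>i j. ev (cend_lcoef a (cend_lcoef b c j) i) s y u)
          (\<lambda>x z. ev a (- x) y (ev b (- z) (y + x) (ev c (s + x + z) (y + x + z) u)))"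
      proof (rule genfun2_swap, rule genfun2I)
        have zero_right: "cend_lcoef a \<zero>\<^bsub>?C\<^esub> n = \<zero>\<^bsub>?C\<^esub>" for n
          using lambda_algebra.lcoef_zero_right[OF lambda, of a n] by simp
        show "ev (cend_lcoef a (cend_lcoef b c j) i) s y u = 0" if "j \<ge> M'" for i j
          using that by (simp add: M' zero_right ev_zero)
        show "genfun (\<lambda>i. ev (cend_lcoef a (cend_lcoef b c j) i) s y u)
           (\<lambda>x. ev a (- x) y (ev (cend_lcoef b c j) (s + x) (y + x) u))" for j
          by (rule genfun_cend_lcoef) (simp_all add: closed)
        show "genfun (\<lambda>j. ev a (- x) y (ev (cend_lcoef b c j) (s + x) (y + x) u))
          (\<lambda>z. ev a (- x) y (ev b (- z) (y + x) (ev c (s + x + z) (y + x + z) u)))" for x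
          by (rule genfun_linear[OF genfun_cend_lcoef]) (simp_all add: ev_vector_add ev_vector_scale)
      qed
      ultimately show "ev (subst_plus ?C ?F i j) s y u = ev (cend_lcoef a (cend_lcoef b c j) i) s y u"
        by (rule genfun2_unique)
    qed (simp add: closed)
  qed
qed


section \<open>The envelope \<open>A(V)\<close> of the Virasoro algebra\<close>
interpretation Cend: assoc_conformal_algebra "Cend_fin :: ('k::field_char_0, 'k cend) conformal"
  by (rule Cend_assoc)

text \<open>At \<open>T = s\<close>, the substitution \<open>\<lambda> \<mapsto> -T - \<lambda>\<close> becomes \<open>z \<mapsto> -s - z\<close>.\<close>
lemma genfun_subst_neg:
  assumes p: "\<And>n. p n \<in> carrier Cend_fin" and fin: "finite {n. p n \<noteq> \<zero>\<^bsub>Cend_fin\<^esub>}"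
    and g: "genfun (\<lambda>n. ev (p n) s y u) g"
  shows "genfun (\<lambda>m. ev (subst_neg Cend_fin p m) s y u) (\<lambda>z. g (- s - z))"
proof -
  let ?S = "{n. p n \<noteq> \<zero>\<^bsub>Cend_fin\<^esub>}" and ?q = "[:- T_H, - 1:] :: 'a poly poly"
  have "ev (subst_neg Cend_fin p m) s y u = (\<Sum>n\<in>?S. poly (coeff (?q ^ n) m) s \<cdot> ev (p n) s y u)" for m
    unfolding subst_neg_def by (subst ev_finsum[OF fin]) (auto simp: p ev_scale)
  moreover have "g (- s - z) = (\<Sum>n\<in>?S. poly (poly (?q ^ n) [:z:]) s \<cdot> ev (p n) s y u)" for z
  proof -
    obtain N where N: "?S \<subseteq> {..<N}"
      using fin unfolding finite_nat_set_iff_bounded by auto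
    have z: "ev (p n) s y u = 0" if "n \<notin> ?S" for n using that by (simp add: ev_zero)
    have "g (- s - z) = (\<Sum>n<N. (- s - z) ^ n \<cdot> ev (p n) s y u)"
      by (rule genfun_eq_sum[OF g]) (use N z in fastforce)
    also have "\<dots> = (\<Sum>n\<in>?S. (- s - z) ^ n \<cdot> ev (p n) s y u)"
      by (rule sum.mono_neutral_right) (use N z in auto)
    also have "\<dots> = (\<Sum>n\<in>?S. poly (poly (?q ^ n) [:z:]) s \<cdot> ev (p n) s y u)"
    proof -
      have "poly (poly ?q [:z:]) s = - s - z" by simp
      then show ?thesis by (simp only: poly_power)
    qed
    finally show ?thesis .
  qed
  ultimately show ?thesis
    by (simp only:) (rule genfun_sum, rule genfun_poly)
qed

text \<open>The operator \<open>D = (d + id) L\<^sub>v\<close>, through which alone \<open>End P\<close> enters \<open>A(V)\<close>; it plays the role of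
  the conformal weight.\<close>
definition weight_op :: "'k::field_char_0 poly \<Rightarrow> 'k poly" where
  "weight_op u = pderiv ([:0, 1:] * u) + [:0, 1:] * u"

lemma weight_op_linear:
  shows weight_op_add: "weight_op (u + v) = weight_op u + weight_op v"
    and weight_op_scale: "weight_op (c \<cdot> u) = c \<cdot> weight_op u"
    and weight_op_diff: "weight_op (u - v) = weight_op u - weight_op v"
  by (rule poly_eqI; simp add: weight_op_def pderiv_pCons coeff_pderiv coeff_pCons algebra_simps
      split: nat.splits)+

lemma tau_v:
  shows tau_v_closed: "tau_v \<in> carrier (Cend_fin :: ('a::field_char_0, 'a cend) conformal)"
    and ev_tau_v: "ev tau_v s y u = (y :: 'a) \<cdot> u - s \<cdot> weight_op u"
proof -
  let ?X = "cend_tensor [:[:0, 1:]:] id :: 'a cend"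
  let ?Y = "cend_tensor [:0, 1:] weight_op :: 'a cend"
  have w: "(\<lambda>w. pderiv w + id w) \<circ> (\<lambda>w. [:0, 1:] * w) = (weight_op :: 'a poly \<Rightarrow> _)"
    by (auto simp: weight_op_def)
  have eq: "tau_v = ?X \<oplus>\<^bsub>Cend_fin\<^esub> (\<lambda>i j u. (- 1) \<cdot> ?Y i j u)"
    unfolding tau_v_def w by (simp add: Cend_fin_def)
  have X: "?X \<in> carrier Cend_fin" "ev ?X s y u = y \<cdot> u"
    by (auto intro!: cend_tensor_closed simp: ev_tensor)
  have Y: "?Y \<in> carrier Cend_fin" "ev ?Y s y u = s \<cdot> weight_op u"
    by (auto intro!: cend_tensor_closed simp: ev_tensor weight_op_linear)
  show "tau_v \<in> carrier (Cend_fin :: ('a, 'a cend) conformal)"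
    unfolding eq by (rule cend_add_closed[OF X(1) cend_const_scale(1)[OF Y(1)]])
  show "ev tau_v s y u = y \<cdot> u - s \<cdot> weight_op u"
    unfolding eq ev_add[OF X(1) cend_const_scale(1)[OF Y(1)]] cend_const_scale(2)[OF Y(1)] X Y
    by simp
qed

lemma ev_lcoef_tau_v:
  "ev (cend_lcoef tau_v tau_v n) s y u =
     (if n = 0 then y\<^sup>2 \<cdot> u - (s * y) \<cdot> weight_op u
      else if n = 1 then y \<cdot> u - s \<cdot> weight_op (weight_op u)
      else if n = 2 then weight_op u - weight_op (weight_op u) else 0)"
  by (rule genfun_eq[OF genfun_cend_lcoef[OF tau_v_closed tau_v_closed] genfun_quadratic])
    (simp add: ev_tau_v weight_op_linear smult_add_left smult_add_right smult_diff_right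
      algebra_simps power2_eq_square)

lemma A_V_subalgebra: "conformal_subalgebra (generated_by Cend_fin {tau_v}) Cend_fin"
  by (rule Cend.generated_by_subalgebra) (simp add: tau_v_closed)

lemma tau_v_in_generated: "tau_v \<in> generated_by Cend_fin {tau_v}"
  by (auto simp: generated_by_def)

lemma A_V_assoc: "assoc_conformal_algebra A_V"
  unfolding A_V_def by (rule Cend.assoc_subalgebra[OF A_V_subalgebra])

lemma lcoef_Vir: "lcoef Vir f g n = coeff (Vir_bracket f g) n"
  by (simp add: Vir_def)

lemma poly_Vir_bracket:
  "poly (poly (Vir_bracket f g) [:z:]) s = poly f (- z) * poly g (s + z) * (s + 2 * z)"
proof -
  have lift: "poly (poly (poly (map_poly (\<lambda>c. [:[:c:]:]) f) q) [:z:]) s = poly f (poly (poly q [:z:]) s)"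
    for f :: "'a poly" and q
    by (induction f) (auto simp: map_poly_pCons)
  show ?thesis
    by (simp add: Vir_bracket_def lift algebra_simps)
qed

lemma commutator_lcoef:
  "lcoef (commutator_algebra A) a b n = lcoef A a b n \<ominus>\<^bsub>A\<^esub> subst_neg A (lcoef A b a) n"
  by (simp add: commutator_algebra_def)

text \<open>At scalars \<open>\<tau>(v)\<close> is \<open>y - s D\<close>, and the commutator of \<open>\<tau>(v)\<close> with itself is
  \<open>(y + z D)(y + z - (s + z) D) - (y - (s + z) D)(y - s - z + z D) = (s + 2 z)(y - s D)\<close>, for any \<open>D\<close>; the factors
  \<open>f(-z) g(s + z)\<close> come from sesquilinearity on either side.\<close>
lemma commutator_tau_v:
  "(lcoef Vir f g n) \<odot>\<^bsub>Cend_fin\<^esub> tau_v =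
     lcoef (commutator_algebra Cend_fin) (f \<odot>\<^bsub>Cend_fin\<^esub> tau_v) (g \<odot>\<^bsub>Cend_fin\<^esub> tau_v) n"
proof -
  let ?f = "f \<odot>\<^bsub>Cend_fin\<^esub> tau_v" and ?g = "g \<odot>\<^bsub>Cend_fin\<^esub> tau_v"
  have c [simp]: "?f \<in> carrier Cend_fin" "?g \<in> carrier Cend_fin"
    by (simp_all add: cend_scale_closed tau_v_closed)
  have p [simp]: "cend_lcoef ?g ?f m \<in> carrier Cend_fin" "cend_lcoef ?f ?g m \<in> carrier Cend_fin" for m
    by (simp_all add: cend_lcoef_closed)
  have fin: "finite {n. cend_lcoef ?g ?f n \<noteq> \<zero>\<^bsub>Cend_fin\<^esub>}" by (simp add: cend_lcoef_finite)
  have sn [simp]: "subst_neg Cend_fin (cend_lcoef ?g ?f) n \<in> carrier Cend_fin"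
    unfolding subst_neg_def by (rule Cend.finsum_closed) (auto intro: cend_scale_closed)
  have two: "w * 2 = 2 \<cdot> w" for w :: "'a poly"
    by (metis mult_2_right one_add_one smult_1_left smult_add_left)
  show ?thesis unfolding commutator_lcoef lcoef_Cend lcoef_Vir
  proof (rule ev_eqI)
    fix s y u
    have "poly (coeff (Vir_bracket f g) n) s \<cdot> ev tau_v s y u =
        ev (cend_lcoef ?f ?g n) s y u - ev (subst_neg Cend_fin (cend_lcoef ?g ?f) n) s y u"
    proof (rule genfun_eq[OF genfun_poly genfun_diff[OF genfun_cend_lcoef genfun_subst_neg[OF _ _ genfun_cend_lcoef]]])
      show "poly (poly (Vir_bracket f g) [:z:]) s \<cdot> ev tau_v s y u =
         ev ?f (- z) y (ev ?g (s + z) (y + z) u) -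
         ev ?g (- (- s - z)) y (ev ?f (s + (- s - z)) (y + (- s - z)) u)" for z
        by (simp add: poly_Vir_bracket ev_scale tau_v_closed ev_tau_v weight_op_linear
            smult_add_left smult_add_right smult_diff_right smult_diff_left algebra_simps two)
    qed (simp_all add: fin)
    then show "ev (coeff (Vir_bracket f g) n \<odot>\<^bsub>Cend_fin\<^esub> tau_v) s y u =
      ev (cend_lcoef ?f ?g n \<ominus>\<^bsub>Cend_fin\<^esub> subst_neg Cend_fin (cend_lcoef ?g ?f) n) s y u"
      by (simp add: ev_scale tau_v_closed a_minus_def ev_add ev_minus)
  qed (simp_all add: cend_scale_closed tau_v_closed)
qed

lemma A_V_envelope:
  assumes "lie_conformal_algebra (Vir :: ('k::field_char_0, 'k poly) conformal)"
  shows "assoc_envelope Vir A_V (\<lambda>f :: 'k poly. f \<odot>\<^bsub>Cend_fin\<^esub> tau_v)"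
  unfolding assoc_envelope_def
proof (intro conjI assms A_V_assoc)
  let ?B = "generated_by Cend_fin {tau_v :: 'k cend}"
  let ?\<tau> = "\<lambda>f :: 'k poly. f \<odot>\<^bsub>Cend_fin\<^esub> tau_v"
  have \<tau>: "?\<tau> f \<in> ?B" for f
    by (rule Cend.subalgebra_scale[OF A_V_subalgebra tau_v_in_generated])
  have A_V_sel: "carrier A_V = ?B" "add A_V = add Cend_fin" "module.smult A_V = module.smult Cend_fin"
      "lcoef A_V = cend_lcoef" 
    by (simp_all add: A_V_def)
  show "?\<tau> \<in> conformal_hom Vir (commutator_algebra A_V)"
    unfolding conformal_hom_def
  proof (intro CollectI conjI ballI allI)
    show "?\<tau> \<in> carrier Vir \<rightarrow> carrier (commutator_algebra A_V)"
      using \<tau> by (simp add: commutator_algebra_def A_V_sel)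
    show "?\<tau> (f \<oplus>\<^bsub>Vir\<^esub> g) = ?\<tau> f \<oplus>\<^bsub>commutator_algebra A_V\<^esub> ?\<tau> g" for f g
      by (simp add: commutator_algebra_def A_V_sel Vir_def Cend.scalar_add tau_v_closed)
    show "?\<tau> (h \<odot>\<^bsub>Vir\<^esub> f) = h \<odot>\<^bsub>commutator_algebra A_V\<^esub> ?\<tau> f" for h f
      by (simp add: commutator_algebra_def A_V_sel Vir_def Cend.scalar_mult tau_v_closed)
    show "?\<tau> (lcoef Vir f g n) = lcoef (commutator_algebra A_V) (?\<tau> f) (?\<tau> g) n" for f g n
    proof -
      have lc: "lcoef Cend_fin (?\<tau> g) (?\<tau> f) m \<in> ?B" for m
        by (rule Cend.subalgebra_lcoef[OF A_V_subalgebra \<tau> \<tau>])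
      have "subst_neg Cend_fin (lcoef Cend_fin (?\<tau> g) (?\<tau> f)) n \<in> ?B"
        unfolding subst_neg_def
        by (rule Cend.finsum_mem_subalgebra[OF A_V_subalgebra])
          (use lc in \<open>auto intro: Cend.subalgebra_scale[OF A_V_subalgebra]\<close>)
      then show ?thesis
        using lc unfolding commutator_tau_v commutator_lcoef A_V_def
        by (simp add: Cend.subst_neg_subalgebra[OF A_V_subalgebra]
            Cend.minus_minus_subalgebra[OF A_V_subalgebra])
    qed
  qed
  show "generated_by A_V (?\<tau> ` carrier Vir) = carrier A_V"
  proof
    interpret A: assoc_conformal_algebra "A_V :: ('k, 'k cend) conformal" by (rule A_V_assoc)
    have sub: "?\<tau> ` carrier Vir \<subseteq> carrier A_V" using \<tau> by (auto simp: A_V_sel)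
    show "generated_by A_V (?\<tau> ` carrier Vir) \<subseteq> carrier A_V"
      by (rule A.subalgebra_subset[OF A.generated_by_subalgebra[OF sub]])
    have "conformal_subalgebra (generated_by A_V (?\<tau> ` carrier Vir)) Cend_fin"
      using A.generated_by_subalgebra[OF sub] unfolding A_V_def
      by (rule Cend.subalgebra_of_subalgebra[OF A_V_subalgebra])
    moreover have "tau_v \<in> generated_by A_V (?\<tau> ` carrier Vir)"
    proof -
      have "tau_v = ?\<tau> 1" by (simp add: tau_v_closed)
      then have "tau_v \<in> ?\<tau> ` carrier Vir" by (auto simp: Vir_def)
      then show ?thesis by (auto simp: generated_by_def)
    qed
    ultimately show "carrier A_V \<subseteq> generated_by A_V (?\<tau> ` carrier Vir)"
      unfolding A_V_sel generated_by_def[of Cend_fin] by blast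
  qed
qed

lemma lcoef_tau_v_vanish:
  assumes "n \<ge> 3"
  shows "cend_lcoef tau_v tau_v n = \<zero>\<^bsub>Cend_fin\<^esub>"
  by (rule ev_eqI) (use assms in \<open>auto simp: cend_lcoef_closed tau_v_closed ev_lcoef_tau_v ev_zero\<close>)

lemma locality_le_iff:
  assumes "finite {n. lcoef A a b n \<noteq> \<zero>\<^bsub>A\<^esub>}"
  shows "locality A a b \<le> N \<longleftrightarrow> (\<forall>n\<ge>N. lcoef A a b n = \<zero>\<^bsub>A\<^esub>)"
proof (cases "\<forall>n. lcoef A a b n = \<zero>\<^bsub>A\<^esub>")
  case False
  then have ne: "{n. lcoef A a b n \<noteq> \<zero>\<^bsub>A\<^esub>} \<noteq> {}" by auto
  have "locality A a b \<le> N \<longleftrightarrow> Max {n. lcoef A a b n \<noteq> \<zero>\<^bsub>A\<^esub>} < N"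
    using False by (auto simp: locality_def)
  also have "\<dots> \<longleftrightarrow> (\<forall>n\<ge>N. lcoef A a b n = \<zero>\<^bsub>A\<^esub>)"
    using Max_less_iff[OF assms ne] by (auto simp: not_le[symmetric])
  finally show ?thesis .
qed (auto simp: locality_def)

lemma A_V_locality: "locality A_V tau_v tau_v \<le> 3"
proof -
  interpret A: assoc_conformal_algebra A_V by (rule A_V_assoc)
  have t: "tau_v \<in> carrier A_V" by (simp add: A_V_def tau_v_in_generated)
  show ?thesis
    unfolding locality_le_iff[OF A.lcoef_finite[OF t t]]
    by (simp add: A_V_def lcoef_tau_v_vanish)
qed


section \<open>A spanning set for envelopes of locality three\<close>
context lambda_algebra
begin

lemma subst_neg_superset:
  assumes "finite F" "\<And>n. n \<notin> F \<Longrightarrow> p n = \<zero>" "\<And>n. p n \<in> carrier C"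
  shows "subst_neg C p m = (\<Oplus>n\<in>F. coeff ([:- T_H, -1:] ^ n) m \<odot> p n)"
  unfolding subst_neg_def
  by (rule M.add.finprod_mono_neutral_cong_left) (use assms in auto)

text \<open>The \<open>H\<close>-span of a family, built up one term at a time so that closure properties follow by
  rule induction; \<open>hspan_combination\<close> recovers linear combinations with distinct generators.\<close>
inductive_set hspan :: "('i \<Rightarrow> 'a) \<Rightarrow> 'a set" for b :: "'i \<Rightarrow> 'a" where
  hspan_zero: "\<zero> \<in> hspan b"
| hspan_step: "x \<in> hspan b \<Longrightarrow> h \<odot> b i \<oplus> x \<in> hspan b"

context
  fixes b :: "'i \<Rightarrow> 'a"
  assumes b: "\<And>i. b i \<in> carrier C"
begin

lemma hspan_closed: "x \<in> hspan b \<Longrightarrow> x \<in> carrier C"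
  by (induction rule: hspan.induct) (auto simp: b)

lemma hspan_generator: "h \<odot> b i \<in> hspan b" "b i \<in> hspan b"
  using hspan_step[OF hspan_zero, of h b i] hspan_step[OF hspan_zero, of 1 b i] by (simp_all add: b)

lemma hspan_add: "x \<in> hspan b \<Longrightarrow> y \<in> hspan b \<Longrightarrow> x \<oplus> y \<in> hspan b"
  by (induction rule: hspan.induct) (auto simp: b hspan_closed M.a_assoc intro: hspan_step)

lemma hspan_scale: "x \<in> hspan b \<Longrightarrow> g \<odot> x \<in> hspan b"
proof (induction rule: hspan.induct)
  case (hspan_step x h i)
  then have "g \<odot> (h \<odot> b i \<oplus> x) = (g * h) \<odot> b i \<oplus> g \<odot> x"
    by (simp add: b hspan_closed scalar_right_add scalar_mult)
  with hspan_step show ?case by (auto intro: hspan.hspan_step)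
qed (simp add: hspan_zero)

lemma hspan_minus: "x \<in> hspan b \<Longrightarrow> \<ominus> x \<in> hspan b"
  using hspan_scale[of x "- 1"] by (simp add: minus_eq_scalar hspan_closed)

lemma hspan_finsum: "f \<in> A \<rightarrow> hspan b \<Longrightarrow> finsum C f A \<in> hspan b"
proof (induction A rule: infinite_finite_induct)
  case (insert x F)
  then have "f \<in> F \<rightarrow> carrier C" "f x \<in> carrier C" using hspan_closed by auto
  with insert show ?case by (auto intro: hspan_add)
qed (auto simp: hspan_zero M.finsum_infinite)

lemma hspan_combination:
  assumes "x \<in> hspan b"
  shows "\<exists>I c. finite I \<and> x = (\<Oplus>i\<in>I. c i \<odot> b i)"
  using assms
proof (induction rule: hspan.induct)
  case hspan_zero
  show ?case by (intro exI[of _ "{}"]) auto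
next
  case (hspan_step x h k)
  then obtain I c where I: "finite I" and x: "x = (\<Oplus>i\<in>I. c i \<odot> b i)" by blast
  define c' where "c' = (\<lambda>i. if i \<in> I then c i else 0)"
  let ?J = "insert k I"
  have "x = (\<Oplus>i\<in>?J. c' i \<odot> b i)" unfolding x
    by (rule M.add.finprod_mono_neutral_cong_left) (use I in \<open>auto simp: b c'_def\<close>)
  also have "\<dots> = (\<Oplus>i\<in>insert k (I - {k}). c' i \<odot> b i)" by simp
  also have "\<dots> = c' k \<odot> b k \<oplus> (\<Oplus>i\<in>I - {k}. c' i \<odot> b i)"
    by (rule M.finsum_insert) (use I in \<open>auto simp: b\<close>)
  finally have "h \<odot> b k \<oplus> x = (h + c' k) \<odot> b k \<oplus> (\<Oplus>i\<in>I - {k}. c' i \<odot> b i)"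
    by (simp add: b scalar_add M.a_assoc)
  also have "(\<Oplus>i\<in>I - {k}. c' i \<odot> b i) = (\<Oplus>i\<in>I - {k}. (c'(k := h + c' k)) i \<odot> b i)"
    by (rule M.finsum_cong') (auto simp: b)
  also have "(h + c' k) \<odot> b k \<oplus> \<dots> = (\<Oplus>i\<in>insert k (I - {k}). (c'(k := h + c' k)) i \<odot> b i)"
    by (subst M.finsum_insert) (use I in \<open>auto simp: b\<close>)
  finally show ?case
    using I by (intro exI[of _ "?J"] exI[of _ "c'(k := h + c' k)"] conjI) (simp_all only: insert_Diff_single finite_insert)
qed

end

end

text \<open>What an envelope of \<open>Vir\<close> of locality at most \<open>3\<close> remembers of the generator \<open>w\<close>: the last assumption
  is the commutator relation, solved for the coefficient of \<open>\<lambda>\<close>.\<close>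
locale virasoro_generator = assoc_conformal_algebra A
  for A :: "('k::field_char_0, 'a) conformal" (structure) +
  fixes w :: 'a
  assumes w_closed [simp]: "w \<in> carrier A"
    and w_local: "n \<ge> 3 \<Longrightarrow> lcoef A w w n = \<zero>"
    and w_first: "lcoef A w w (Suc 0) = w \<oplus> T_H \<odot> lcoef A w w 2"
begin

text \<open>Coefficients of \<open>\<lambda>\<^sup>n\<close> and not \<open>n\<close>-products: in the usual notation \<open>n! L n c\<close> is \<open>w\<^sub>(\<^sub>n\<^sub>) c\<close>.\<close>
definition L :: "nat \<Rightarrow> 'a \<Rightarrow> 'a" where "L n c = lcoef A w c n"

text \<open>Left multiplication by the coefficient of \<open>\<lambda>\<^sup>m\<close> in the product of \<open>w\<close> with itself.\<close>
definition W :: "nat \<Rightarrow> nat \<Rightarrow> 'a \<Rightarrow> 'a" where "W m n c = lcoef A (lcoef A w w m) c n"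

lemma L_closed [simp, intro]: "c \<in> carrier A \<Longrightarrow> L n c \<in> carrier A"
  by (simp add: L_def lcoef_closed)

lemma W_closed [simp, intro]: "c \<in> carrier A \<Longrightarrow> W m n c \<in> carrier A"
  by (simp add: W_def lcoef_closed)

lemma L_zero [simp]: "L n \<zero> = \<zero>"
  by (simp add: L_def)

lemma L_add: "\<lbrakk>c \<in> carrier A; d \<in> carrier A\<rbrakk> \<Longrightarrow> L n (c \<oplus> d) = L n c \<oplus> L n d"
  by (simp add: L_def lcoef_add_right)

lemma L_T:
  assumes "c \<in> carrier A"
  shows "L 0 (T_H \<odot> c) = T_H \<odot> L 0 c" "L (Suc n) (T_H \<odot> c) = T_H \<odot> L (Suc n) c \<oplus> L n c"
  using assms lcoef_T_right[of w c] by (simp_all add: L_def lam_times_def lcoef_closed)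

lemma L_const: "c \<in> carrier A \<Longrightarrow> L n ([:r:] \<odot> c) = [:r:] \<odot> L n c"
  by (simp add: L_def lcoef_scale_right)

lemma W_vanish: "c \<in> carrier A \<Longrightarrow> m \<ge> 3 \<Longrightarrow> W m n c = \<zero>"
  by (simp add: W_def w_local)

lemma W_first:
  assumes [simp]: "c \<in> carrier A"
  shows W_first_0: "W (Suc 0) 0 c = L 0 c" and W_first_Suc: "W (Suc 0) (Suc n) c = L (Suc n) c \<ominus> W 2 n c"
proof -
  have "W (Suc 0) k c = L k c \<oplus> \<ominus> lam_times A (\<lambda>n. W 2 n c) k" for k
    unfolding W_def w_first by (simp add: lcoef_add_left lcoef_T_left lcoef_closed L_def)
  then show "W (Suc 0) 0 c = L 0 c" "W (Suc 0) (Suc n) c = L (Suc n) c \<ominus> W 2 n c"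
    by (simp_all add: lam_times_def M.minus_eq)
qed

text \<open>By locality only \<open>W 0\<close>, \<open>W 1\<close>, \<open>W 2\<close> survive on the right-hand side. Fewer than three terms are present for
  \<open>i < 2\<close>, whence the three cases below.\<close>
lemma L_L: "c \<in> carrier A \<Longrightarrow> L i (L j c) = (\<Oplus>n\<in>{j..i + j}. of_nat (n choose j) \<odot> W (i + j - n) n c)"
  using associativity[of w w c i j] by (simp add: L_def W_def subst_plus_def)

lemma L_L_0: "c \<in> carrier A \<Longrightarrow> L 0 (L n c) = W 0 n c"
  by (simp add: L_L)

lemma L_L_1:
  assumes "c \<in> carrier A"
  shows "L (Suc 0) (L n c) = of_nat (Suc n) \<odot> W 0 (Suc n) c \<oplus> W (Suc 0) n c"
proof -
  have "{n..1 + n} = {Suc n, n}" by auto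
  then have "L (Suc 0) (L n c) = of_nat (Suc n choose n) \<odot> W (Suc n - Suc n) (Suc n) c
      \<oplus> of_nat (n choose n) \<odot> W (Suc n - n) n c"
    using assms by (simp add: L_L del: of_nat_Suc binomial_Suc_n binomial_n_n)
  then show ?thesis using assms by (simp add: Suc_diff_le del: of_nat_Suc One_nat_def)
qed

lemma L_L_Suc_Suc:
  assumes "c \<in> carrier A"
  shows "L (Suc (Suc i)) (L j c) = of_nat (Suc (Suc (i + j)) choose j) \<odot> W 0 (Suc (Suc (i + j))) c
    \<oplus> of_nat (Suc (i + j) choose j) \<odot> W (Suc 0) (Suc (i + j)) c \<oplus> of_nat ((i + j) choose j) \<odot> W 2 (i + j) c"
proof -
  have *: "\<And>n. n \<in> {j..Suc (Suc i) + j} - {Suc (Suc (i + j)), Suc (i + j), i + j} \<Longrightarrow> Suc (Suc i) + j - n \<ge> 3"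
    by auto
  have "L (Suc (Suc i)) (L j c) = (\<Oplus>n\<in>{Suc (Suc (i + j)), Suc (i + j), i + j}.
      of_nat (n choose j) \<odot> W (Suc (Suc i) + j - n) n c)"
    unfolding L_L[OF assms]
    by (rule M.add.finprod_mono_neutral_cong_right) (use assms * in \<open>auto simp: W_vanish\<close>)
  also have "\<dots> = of_nat (Suc (Suc (i + j)) choose j) \<odot> W 0 (Suc (Suc (i + j))) c
    \<oplus> (of_nat (Suc (i + j) choose j) \<odot> W (Suc 0) (Suc (i + j)) c \<oplus> of_nat ((i + j) choose j) \<odot> W 2 (i + j) c)"
    using assms by (simp add: Suc_diff_le numeral_2_eq_2 del: binomial_Suc_Suc)
  finally show ?thesis using assms by (simp add: M.a_assoc)
qed

text \<open>Both products contain \<open>W 0 (Suc n) c\<close>; by \<open>W_first\<close> the remaining terms of the left one collapse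
  to \<open>L n c\<close>.\<close>
lemma L_comm_0:
  assumes [simp]: "c \<in> carrier A"
  shows "L (Suc n) (L 0 c) = L 0 (L (Suc n) c) \<oplus> L n c"
proof (cases n)
  case 0
  then show ?thesis using L_L_1[of c 0] by (simp add: L_L_0 W_first_0)
next
  case (Suc i)
  have "L (Suc n) (L 0 c) = W 0 (Suc n) c \<oplus> (W (Suc 0) (Suc i) c \<oplus> W 2 i c)"
    using L_L_Suc_Suc[of c i 0] by (simp add: Suc M.a_assoc)
  also have "W (Suc 0) (Suc i) c \<oplus> W 2 i c = L (Suc i) c"
    by (simp add: W_first_Suc M.minus_eq M.a_assoc M.l_neg)
  finally show ?thesis by (simp add: L_L_0 Suc)
qed

text \<open>In general \<open>L n (L 1 c) = L 1 (L n c) + (n - 1) L n c\<close> for \<open>n \<ge> 2\<close>; only the kernel of \<open>L n\<close> is needed.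
  There all terms are multiples of \<open>x = W 2 (n - 1) c\<close>, with coefficients \<open>1\<close>, \<open>-n\<close> and \<open>n - 1\<close>.\<close>
lemma L_comm_1:
  assumes [simp]: "c \<in> carrier A" and n: "n \<ge> 2" and z: "L n c = \<zero>"
  shows "L n (L (Suc 0) c) = \<zero>"
proof -
  obtain i where i: "n = Suc (Suc i)" using n by (metis add_2_eq_Suc le_Suc_ex)
  define x where "x = W 2 (Suc i) c"
  have [simp]: "x \<in> carrier A" by (simp add: x_def)
  have W1: "W (Suc 0) n c = \<ominus> x"
    using z by (simp add: i W_first_Suc x_def M.minus_eq)
  have "of_nat (Suc n) \<odot> W 0 (Suc n) c \<oplus> \<ominus> x = \<zero>"
    using L_L_1[of c n] by (simp add: z W1)
  then have W0: "of_nat (Suc n) \<odot> W 0 (Suc n) c = x"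
    by (metis M.add.inv_closed M.minus_equality M.minus_minus W_closed assms(1) \<open>x \<in> carrier A\<close> scalar_closed)
  have "L n (L (Suc 0) c) = of_nat (Suc n) \<odot> W 0 (Suc n) c \<oplus> of_nat n \<odot> W (Suc 0) n c \<oplus> of_nat (Suc i) \<odot> x"
    using L_L_Suc_Suc[of c i 1] by (simp add: i x_def)
  also have "\<dots> = 1 \<odot> x \<oplus> (- of_nat n) \<odot> x \<oplus> of_nat (Suc i) \<odot> x"
    unfolding W0 W1 by (simp add: scalar_right_minus scalar_uminus)
  also have "\<dots> = (1 + (- of_nat n) + of_nat (Suc i)) \<odot> x"
    by (simp only: scalar_add \<open>x \<in> carrier A\<close>)
  also have "1 + (- of_nat n) + of_nat (Suc i) = (0 :: 'k poly)" by (simp add: i)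
  finally show ?thesis by simp
qed

lemma L_w: "n \<ge> 3 \<Longrightarrow> L n w = \<zero>"
  by (simp add: L_def w_local)

text \<open>All \<open>W m k w\<close> with large \<open>k\<close> vanish: \<open>W 0 k w\<close> and \<open>W 1 k w\<close> because \<open>L k w = 0\<close> for \<open>k \<ge> 3\<close>, and
  \<open>W 2 k w\<close> by \<open>W_first\<close>.\<close>
lemma L_L_2_w:
  assumes n: "n \<ge> 2"
  shows "L n (L 2 w) = \<zero>"
proof -
  obtain i where i: "n = Suc (Suc i)" using n by (metis add_2_eq_Suc le_Suc_ex)
  have W0: "W 0 k w = \<zero>" if "k \<ge> 3" for k
    using L_L_0[of w k] L_w[OF that] by simp
  have W1: "W (Suc 0) k w = \<zero>" if "k \<ge> 3" for k
    using L_L_1[of w k] L_w[OF that] that by (simp add: W0)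
  have W2: "W 2 k w = \<zero>" if "k \<ge> 2" for k
  proof -
    have "\<zero> \<ominus> W 2 k w = \<zero>"
      using W_first_Suc[of w k] W1[of "Suc k"] L_w[of "Suc k"] that by simp
    then show ?thesis by (simp add: M.minus_eq M.add.inv_eq_1_iff)
  qed
  show ?thesis
    using L_L_Suc_Suc[of w i 2] by (simp add: i W0 W1 W2)
qed

text \<open>Both families of words under one index: \<open>word (0, n) = L\<^sub>0\<^sup>n w\<close> and
  \<open>word (k + 1, n) = L\<^sub>0\<^sup>n L\<^sub>1\<^sup>k p\<^sub>2\<close> with \<open>p\<^sub>2 = L\<^sub>2 w\<close>.\<close>
definition word :: "nat \<times> nat \<Rightarrow> 'a" where
  "word mn = (L 0 ^^ snd mn) (case fst mn of 0 \<Rightarrow> w | Suc k \<Rightarrow> (L (Suc 0) ^^ k) (L 2 w))"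

lemma funpow_L_closed: "c \<in> carrier A \<Longrightarrow> (L i ^^ k) c \<in> carrier A"
  by (induction k) auto

lemma word_closed [simp]: "word mn \<in> carrier A"
  by (auto simp: word_def intro!: funpow_L_closed split: nat.splits)

lemmas span_closed = hspan_closed[of word, OF word_closed]
  and span_zero = hspan_zero[of word]
  and span_word = hspan_generator[of word, OF word_closed]
  and span_add = hspan_add[of word, OF word_closed]
  and span_scale = hspan_scale[of word, OF word_closed]
  and span_minus = hspan_minus[of word, OF word_closed]
  and span_finsum = hspan_finsum[of word, OF word_closed]

lemma word_Suc: "word (m, Suc n) = L 0 (word (m, n))"
  by (simp add: word_def)

lemma L_higher_word: "n \<ge> 2 \<Longrightarrow> L n (word (Suc k, 0)) = \<zero>"
proof (induction k)
  case 0
  then show ?case by (simp add: word_def L_L_2_w)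
next
  case (Suc k)
  have "word (Suc (Suc k), 0) = L (Suc 0) (word (Suc k, 0))" by (simp add: word_def)
  then show ?case using Suc by (simp add: L_comm_1)
qed

text \<open>The operators \<open>L n\<close> are not \<open>H\<close>-linear, since \<open>L (n + 1) T = T L (n + 1) + L n\<close>; therefore all
  indices \<open>n\<close> are treated at the same time.\<close>
lemma L_scale_mem:
  assumes "\<And>n. L n c \<in> hspan word" and [simp]: "c \<in> carrier A"
  shows "L n (h \<odot> c) \<in> hspan word"
proof (induction h arbitrary: n)
  case 0
  then show ?case by (simp add: span_zero)
next
  case (pCons r h)
  have "pCons r h = [:r:] + T_H * h" by simp
  then have "pCons r h \<odot> c = [:r:] \<odot> c \<oplus> T_H \<odot> (h \<odot> c)"
    by (simp only: scalar_add scalar_mult \<open>c \<in> carrier A\<close>)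
  then have "L n (pCons r h \<odot> c) = [:r:] \<odot> L n c \<oplus> L n (T_H \<odot> (h \<odot> c))"
    by (simp add: L_add L_const)
  moreover have "L n (T_H \<odot> (h \<odot> c)) \<in> hspan word"
    by (cases n) (auto simp: L_T intro!: span_add span_scale pCons)
  ultimately show ?case by (auto intro!: span_add span_scale assms)
qed


lemma L_0_hspan: "x \<in> hspan word \<Longrightarrow> L 0 x \<in> hspan word"
proof (induction rule: hspan.induct)
  case (hspan_step x h mn)
  have "L 0 (h \<odot> word mn) = h \<odot> L 0 (word mn)"
  proof (induction h)
    case (pCons r h)
    have "pCons r h = [:r:] + T_H * h" by simp
    then have *: "pCons r h \<odot> c = [:r:] \<odot> c \<oplus> T_H \<odot> (h \<odot> c)" if "c \<in> carrier A" for c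
      using that by (simp only: scalar_add scalar_mult)
    show ?case by (simp add: * L_add L_const L_T pCons)
  qed simp
  also have "\<dots> = h \<odot> word (fst mn, Suc (snd mn))" by (simp add: word_Suc)
  also have "\<dots> \<in> hspan word" by (simp add: span_word)
  finally show ?case
    using hspan_step span_closed[of x] by (simp add: L_add span_add)
qed (simp add: span_zero)

text \<open>Moving \<open>L k\<close> to the right past \<open>L 0\<close> only produces \<open>L (k - 1)\<close>, so that everything reduces to the words
  without \<open>L 0\<close>. On \<open>w\<close>, the four cases are \<open>L\<^sub>0 w\<close>, \<open>L\<^sub>1 w = w + T p\<^sub>2\<close>, \<open>L\<^sub>2 w = p\<^sub>2\<close> and \<open>0\<close>.\<close>
lemma L_word: "L k (word (m, n)) \<in> hspan word"
proof (induction n arbitrary: k)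
  case 0
  show ?case
  proof (cases m)
    case 0
    have w: "word (0, 0) = w" and e: "L 2 w = word (1, 0)" by (simp_all add: word_def)
    consider "k = 0" | "k = 1" | "k = 2" | "k \<ge> 3" by linarith
    then show ?thesis
    proof cases
      case 1
      then show ?thesis by (auto simp: 0 span_word simp flip: word_Suc)
    next
      case 2
      have "L (Suc 0) w = word (0, 0) \<oplus> T_H \<odot> word (1, 0)"
        unfolding w e[symmetric] using w_first by (simp add: L_def)
      moreover have "word (0, 0) \<oplus> T_H \<odot> word (1, 0) \<in> hspan word"
        by (intro span_add span_word)
      ultimately show ?thesis by (simp add: 0 2 w)
    qed (auto simp: 0 w e span_word L_w span_zero)
  next
    case (Suc q)
    consider "k = 0" | "k = 1" | "k \<ge> 2" by linarith
    then show ?thesis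
    proof cases
      case 1
      then show ?thesis by (auto simp: span_word simp flip: word_Suc)
    next
      case 2
      have "L (Suc 0) (word (Suc q, 0)) = word (Suc m, 0)" by (simp add: word_def Suc)
      then show ?thesis by (simp add: 2 Suc span_word)
    qed (auto simp: Suc L_higher_word span_zero)
  qed
next
  case (Suc n)
  show ?case
  proof (cases k)
    case 0
    then show ?thesis by (simp add: span_word flip: word_Suc)
  next
    case (Suc j)
    show ?thesis
      by (auto simp: Suc word_Suc L_comm_0 intro!: span_add L_0_hspan Suc.IH)
  qed
qed

lemma L_hspan: "x \<in> hspan word \<Longrightarrow> L k x \<in> hspan word"
proof (induction rule: hspan.induct)
  case (hspan_step x h mn)
  have "L k (h \<odot> word mn) \<in> hspan word"
    by (rule L_scale_mem) (use L_word[of _ "fst mn" "snd mn"] in auto)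
  then show ?case
    using hspan_step span_closed[of x] by (simp add: L_add span_add)
qed (simp add: span_zero)

text \<open>The coefficients of \<open>((a \<^sub>\<lambda> b) \<^sub>\<nu> x)\<close> are recovered from those of
  \<open>(a \<^sub>\<lambda> (b \<^sub>\<mu> x))\<close>: the associativity relation with indices \<open>m\<close>, \<open>n\<close> is triangular, its first
  term is the one wanted and all others belong to smaller \<open>m\<close>.\<close>
lemma stabilizer_subalgebra:
  "conformal_subalgebra {a \<in> carrier A. \<forall>x\<in>hspan word. \<forall>n. lcoef A a x n \<in> hspan word} A"
    (is "conformal_subalgebra ?N A")
proof (rule conformal_subalgebraI)
  have S [simp]: "x \<in> carrier A" if "x \<in> hspan word" for x by (rule span_closed[OF that])
  show "\<zero> \<in> ?N" by (auto simp: span_zero)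
  show "a \<oplus> b \<in> ?N" if "a \<in> ?N" "b \<in> ?N" for a b
    using that by (auto simp: lcoef_add_left intro: span_add)
  show "h \<odot> a \<in> ?N" if a: "a \<in> ?N" for h a
  proof -
    have [simp]: "a \<in> carrier A" using a by simp
    have "lcoef A (h \<odot> a) x n \<in> hspan word" if x: "x \<in> hspan word" for x n
    proof (induction h arbitrary: n)
      case 0
      then show ?case by (simp add: span_zero x)
    next
      case (pCons r h)
      have "pCons r h = [:r:] + T_H * h" by simp
      then have "pCons r h \<odot> a = [:r:] \<odot> a \<oplus> T_H \<odot> (h \<odot> a)"
        by (simp only: scalar_add scalar_mult \<open>a \<in> carrier A\<close>)
      then have "lcoef A (pCons r h \<odot> a) x n =
          [:r:] \<odot> lcoef A a x n \<oplus> \<ominus> lam_times A (lcoef A (h \<odot> a) x) n"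
        using x by (simp add: lcoef_add_left lcoef_scale_left lcoef_T_left)
      moreover have "lam_times A (lcoef A (h \<odot> a) x) n \<in> hspan word"
        by (cases n) (auto simp: lam_times_def span_zero pCons)
      ultimately show ?case
        using a x by (auto intro!: span_add span_scale span_minus)
    qed
    then show ?thesis by simp
  qed
  show "lcoef A a b m \<in> ?N" if a: "a \<in> ?N" and b: "b \<in> ?N" for a b m
  proof -
    have [simp]: "a \<in> carrier A" "b \<in> carrier A" using a b by simp_all
    have "lcoef A (lcoef A a b m) x n \<in> hspan word" if x: "x \<in> hspan word" for x n
    proof (induction m arbitrary: n rule: less_induct)
      case (less m)
      let ?t = "\<lambda>k. of_nat (k choose n) \<odot> lcoef A (lcoef A a b (m + n - k)) x k"
      have t: "?t k \<in> carrier A" for k using x by (simp add: lcoef_closed)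
      have "{n..m + n} = insert n {Suc n..m + n}" by auto
      moreover have "(\<Oplus>k\<in>insert n {Suc n..m + n}. ?t k) = ?t n \<oplus> (\<Oplus>k\<in>{Suc n..m + n}. ?t k)"
        by (intro M.finsum_insert t Pi_I) auto
      ultimately have "(\<Oplus>k\<in>{n..m + n}. ?t k) = ?t n \<oplus> (\<Oplus>k\<in>{Suc n..m + n}. ?t k)"
        by (simp only:)
      then have eq: "lcoef A a (lcoef A b x n) m = ?t n \<oplus> (\<Oplus>k\<in>{Suc n..m + n}. ?t k)"
        using associativity[of a b x m n] x by (simp add: subst_plus_def)
      have rest: "(\<Oplus>k\<in>{Suc n..m + n}. ?t k) \<in> hspan word"
        by (rule span_finsum) (auto intro!: span_scale less)
      have "lcoef A (lcoef A a b m) x n = ?t n" using x by (simp add: lcoef_closed)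
      also have "\<dots> = lcoef A a (lcoef A b x n) m \<oplus> \<ominus> (\<Oplus>k\<in>{Suc n..m + n}. ?t k)"
        unfolding eq using t[of n] rest by (simp add: M.a_assoc M.r_neg)
      also have "\<dots> \<in> hspan word"
        using a b x rest by (auto intro!: span_add span_minus)
      finally show ?case .
    qed
    then show ?thesis by (simp add: lcoef_closed)
  qed
qed auto

text \<open>Stability under \<open>w\<close> propagates to the subalgebra generated by \<open>w\<close>, that is, to all left factors; then
  the span is itself a subalgebra containing \<open>w\<close>.\<close>
lemma carrier_eq_hspan:
  assumes "generated_by A {w} = carrier A"
  shows "carrier A = hspan word"
proof
  have S [simp]: "x \<in> carrier A" if "x \<in> hspan word" for x by (rule span_closed[OF that])
  show "hspan word \<subseteq> carrier A" by auto
  let ?N = "{a \<in> carrier A. \<forall>x\<in>hspan word. \<forall>n. lcoef A a x n \<in> hspan word}"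
  have "w \<in> ?N" using L_hspan by (simp add: L_def)
  then have "generated_by A {w} \<subseteq> ?N"
    unfolding generated_by_def using stabilizer_subalgebra by blast
  then have "lcoef A a x n \<in> hspan word" if "a \<in> carrier A" "x \<in> hspan word" for a x n
    using that unfolding assms by blast
  then have "conformal_subalgebra (hspan word) A"
    by (intro conformal_subalgebraI) (auto simp: span_zero intro: span_add span_scale)
  moreover have "w \<in> hspan word" using span_word(2)[of "(0, 0)"] by (simp add: word_def)
  ultimately have "generated_by A {w} \<subseteq> hspan word" unfolding generated_by_def by blast
  then show "carrier A \<subseteq> hspan word" by (simp add: assms)
qed

end


section \<open>Independence of the words in \<open>A(V)\<close>\<close>

text \<open>The functional is forced by \<open>weight_form_weight_op\<close> and its value \<open>1\<close> at \<open>1\<close>: as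
  \<open>D v\<^sup>k = (k + 1) v\<^sup>k + v\<^sup>k\<^sup>+\<^sup>1\<close>, the value at \<open>v\<^sup>k\<^sup>+\<^sup>1\<close> is \<open>z - (k + 1)\<close> times the value at \<open>v\<^sup>k\<close>.\<close>
definition weight_form :: "'k::field_char_0 \<Rightarrow> 'k poly \<Rightarrow> 'k" where
  "weight_form z u = (\<Sum>k\<le>degree u. coeff u k * (\<Prod>r<k. z - of_nat (Suc r)))"

lemma weight_form_eq:
  assumes "degree u < N"
  shows "weight_form z u = (\<Sum>k<N. coeff u k * (\<Prod>r<k. z - of_nat (Suc r)))"
  unfolding weight_form_def
  by (rule sum.mono_neutral_left) (use assms in \<open>auto simp: not_le coeff_eq_0\<close>)

lemma weight_form_add: "weight_form z (u + v) = weight_form z u + weight_form z v"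
proof -
  define N where "N = Suc (max (degree u) (degree v))"
  have "degree u < N" "degree v < N" "degree (u + v) < N"
    using degree_add_le_max[of u v] by (auto simp: N_def)
  then show ?thesis by (simp add: weight_form_eq[of _ N] ring_distribs sum.distrib del: of_nat_Suc)
qed

lemma weight_form_scale: "weight_form z (c \<cdot> u) = c * weight_form z u"
  using weight_form_eq[of "c \<cdot> u" "Suc (degree u)" z] degree_smult_le[of c u]
  by (simp add: weight_form_def sum_distrib_left mult.assoc lessThan_Suc_atMost del: of_nat_Suc)

lemma weight_form_diff: "weight_form z (u - v) = weight_form z u - weight_form z v"
  using weight_form_add[of z u "(- 1) \<cdot> v"] weight_form_scale[of z "- 1" v] by simp

lemma weight_form_sum: "weight_form z (\<Sum>i\<in>I. f i) = (\<Sum>i\<in>I. weight_form z (f i))"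
  by (induction I rule: infinite_finite_induct) (auto simp: weight_form_add, auto simp: weight_form_def)

lemma weight_form_one [simp]: "weight_form z 1 = 1"
  by (simp add: weight_form_def)

lemma weight_form_weight_op: "weight_form z (weight_op u) = z * weight_form z u"
proof -
  let ?P = "\<lambda>k. \<Prod>r<k. z - of_nat (Suc r)"
  define N where "N = Suc (degree u)"
  have N: "degree u < N" by (simp add: N_def)
  have "weight_op u = u + pCons 0 (pderiv u) + pCons 0 u"
    by (simp add: weight_op_def pderiv_pCons)
  then have co: "coeff (weight_op u) 0 = coeff u 0"
      "coeff (weight_op u) (Suc k) = of_nat (Suc (Suc k)) * coeff u (Suc k) + coeff u k" for k
    by (simp_all add: coeff_pderiv algebra_simps)
  have "degree (weight_op u) < Suc N"
  proof (rule le_imp_less_Suc, rule degree_le, intro allI impI)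
    fix k assume "N < k"
    then show "coeff (weight_op u) k = 0" using N by (cases k) (auto simp: co coeff_eq_0)
  qed
  then have "weight_form z (weight_op u) = (\<Sum>k<Suc N. coeff (weight_op u) k * ?P k)" by (rule weight_form_eq)
  also have "\<dots> = coeff u 0 + (\<Sum>k<N. (of_nat (Suc (Suc k)) * coeff u (Suc k) + coeff u k) * ?P (Suc k))"
    unfolding sum.lessThan_Suc_shift by (simp add: co)
  also have "\<dots> = coeff u 0 * ?P 0 + (\<Sum>k<N. of_nat (Suc (Suc k)) * coeff u (Suc k) * ?P (Suc k))
      + (\<Sum>k<N. coeff u k * ?P (Suc k))"
    by (simp add: ring_distribs sum.distrib del: prod.lessThan_Suc)
  also have "coeff u 0 * ?P 0 + (\<Sum>k<N. of_nat (Suc (Suc k)) * coeff u (Suc k) * ?P (Suc k)) =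
      (\<Sum>k<Suc N. of_nat (Suc k) * coeff u k * ?P k)"
    unfolding sum.lessThan_Suc_shift by (simp del: prod.lessThan_Suc)
  also have "\<dots> = (\<Sum>k<N. of_nat (Suc k) * coeff u k * ?P k)"
    using N by (simp add: coeff_eq_0)
  also have "\<dots> + (\<Sum>k<N. coeff u k * ?P (Suc k)) = (\<Sum>k<N. z * (coeff u k * ?P k))"
    unfolding sum.distrib[symmetric] by (rule sum.cong) (simp_all add: algebra_simps)
  also have "\<dots> = z * weight_form z u" by (simp add: weight_form_eq[OF N] sum_distrib_left)
  finally show ?thesis .
qed

lemma weight_form_weight_op_power: "weight_form z ((weight_op ^^ k) u) = z ^ k * weight_form z u"
  by (induction k) (simp_all add: weight_form_weight_op)

lemma monomials_independent:
  fixes a :: "'i \<Rightarrow> 'k::field_char_0"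
  assumes "finite I" "inj_on e I" "\<And>y. (\<Sum>i\<in>I. a i * y ^ e i) = 0" "j \<in> I"
  shows "a j = 0"
proof -
  define p where "p = (\<Sum>i\<in>I. monom (a i) (e i))"
  have "poly p y = 0" for y using assms(3) by (simp add: p_def poly_sum poly_monom)
  then have "p = 0" by (intro iffD1[OF poly_all_0_iff_0] allI)
  moreover have "coeff p (e j) = (\<Sum>i\<in>I. if i = j then a i else 0)"
    unfolding p_def coeff_sum by (rule sum.cong) (use assms in \<open>auto simp: coeff_monom dest: inj_onD\<close>)
  ultimately show ?thesis using assms by simp
qed

text \<open>At \<open>z = 0\<close> the second family vanishes and the first one becomes \<open>y\<^sup>n\<^sup>+\<^sup>1\<close>. What remains is divisible by
  \<open>1 - z\<close>, and the quotient is a combination of distinct monomials \<open>y\<^sup>n z\<^sup>k\<^sup>+\<^sup>1\<close>.\<close>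
lemma words_independent:
  fixes c :: "nat \<times> nat \<Rightarrow> 'k::field_char_0 poly"
  assumes I: "finite I"
    and zero: "\<And>s y z. (\<Sum>i\<in>I. poly (c i) s * (y ^ snd i *
      (case fst i of 0 \<Rightarrow> y - s * z | Suc k \<Rightarrow> z ^ Suc k - z ^ Suc (Suc k)))) = 0"
    and i: "i \<in> I"
  shows "c i = 0"
proof -
  let ?d = "\<lambda>i s y z. case fst i of 0 \<Rightarrow> y - s * z | Suc k \<Rightarrow> z ^ Suc k - z ^ Suc (Suc k)"
  have c0: "poly (c i) s = 0" if "i \<in> I" "fst i = 0" for i s
  proof (rule monomials_independent[where I = "{i \<in> I. fst i = 0}" and e = "\<lambda>i. Suc (snd i)"])
    show "inj_on (\<lambda>i. Suc (snd i)) {i \<in> I. fst i = 0}" by (auto simp: inj_on_def)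
    show "(\<Sum>i\<in>{i \<in> I. fst i = 0}. poly (c i) s * y ^ Suc (snd i)) = 0" for y
    proof -
      have "(\<Sum>i\<in>{i \<in> I. fst i = 0}. poly (c i) s * y ^ Suc (snd i)) =
          (\<Sum>i\<in>I. poly (c i) s * (y ^ snd i * ?d i s y 0))"
        by (rule sum.mono_neutral_cong_left) (use I in \<open>auto split: nat.splits\<close>)
      then show ?thesis using zero by simp
    qed
  qed (use I that in auto)
  show ?thesis
  proof (cases "fst i")
    case 0
    then have "\<forall>s. poly (c i) s = 0" using c0 i by blast
    then show ?thesis by (simp only: poly_all_0_iff_0)
  next
    case (Suc k)
    have "poly (c i) s = 0" for s
    proof (rule monomials_independent[where I = "{i \<in> I. fst i = Suc k}" and e = snd])
      show "inj_on snd {i \<in> I. fst i = Suc k}" by (auto simp: inj_on_def)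
      fix y
      \<comment> \<open>As a function of \<open>z\<close>, the remaining sum is \<open>p\<close> times \<open>1 - z\<close>.\<close>
      define p where "p = (\<Sum>i\<in>I. monom (if fst i = 0 then 0 else poly (c i) s * y ^ snd i) (fst i))"
      have "poly (p * [:1, - 1:]) z = 0" for z
      proof -
        have "poly (p * [:1, - 1:]) z = (\<Sum>i\<in>I. poly (c i) s * (y ^ snd i * ?d i s y z))"
          unfolding p_def sum_distrib_right poly_sum
          by (rule sum.cong) (use c0 in \<open>auto simp: poly_monom algebra_simps split: nat.splits\<close>)
        then show ?thesis using zero by simp
      qed
      then have "p * [:1, - 1:] = 0" by (intro iffD1[OF poly_all_0_iff_0] allI)
      then have "p = 0 \<or> [:1, - 1 :: 'k:] = 0" by (rule iffD1[OF mult_eq_0_iff])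
      then have "p = 0" by simp
      then have "coeff p (Suc k) = 0" by simp
      moreover have "coeff p (Suc k) = (\<Sum>i\<in>{i \<in> I. fst i = Suc k}. poly (c i) s * y ^ snd i)"
        unfolding p_def coeff_sum
        by (rule sum.mono_neutral_cong_right) (use I in \<open>auto simp: coeff_monom\<close>)
      ultimately show "(\<Sum>i\<in>{i \<in> I. fst i = Suc k}. poly (c i) s * y ^ snd i) = 0" by simp
    qed (use I i Suc in auto)
    then show ?thesis by (intro iffD1[OF poly_all_0_iff_0] allI)
  qed
qed

lemma ev_tau_v_product_0:
  assumes "a \<in> carrier Cend_fin"
  shows "ev (cend_lcoef tau_v a 0) s y u = y \<cdot> ev a s y u"
  using genfun_at_0[OF genfun_cend_lcoef[OF tau_v_closed assms]] by (simp add: ev_tau_v)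

lemma ev_tau_v_product_1:
  assumes "a \<in> carrier Cend_fin" "\<And>s y u. ev a s y u = f u"
  shows "ev (cend_lcoef tau_v a (Suc 0)) s y u = weight_op (f u)"
proof -
  have "ev (cend_lcoef tau_v a n) s y u =
      (if n = 0 then y \<cdot> f u else if n = 1 then weight_op (f u) else if n = 2 then 0 else 0)" for n
    by (rule genfun_eq[OF genfun_cend_lcoef[OF tau_v_closed assms(1)] genfun_quadratic])
      (simp add: ev_tau_v assms(2))
  then show ?thesis by simp
qed

section \<open>The isomorphism\<close>

text \<open>The coefficient of \<open>\<lambda>\<close> in \<open>[v \<^sub>\<lambda> v] = (T + 2\<lambda>) v\<close> reads \<open>2 w = 2 p\<^sub>1 - 2 T p\<^sub>2\<close>, because the
  \<open>\<lambda>\<close>-coefficient of \<open>(w \<^sub>-\<^sub>T\<^sub>-\<^sub>\<lambda> w)\<close> is \<open>- p\<^sub>1 + 2 T p\<^sub>2\<close>.\<close>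
lemma envelope_generator:
  fixes U :: "('k::field_char_0, 'u) conformal"
  assumes env: "assoc_envelope Vir U \<tau>" and loc: "locality U (\<tau> 1) (\<tau> 1) \<le> 3"
  shows "virasoro_generator U (\<tau> 1)" "generated_by U {\<tau> 1} = carrier U"
proof -
  interpret U: assoc_conformal_algebra U using env by (simp add: assoc_envelope_def)
  have \<tau>: "\<tau> \<in> conformal_hom Vir (commutator_algebra U)"
    and gen: "generated_by U (\<tau> ` carrier Vir) = carrier U"
    using env by (simp_all add: assoc_envelope_def)
  let ?w = "\<tau> 1"
  have w: "?w \<in> carrier U" using hom_closed[OF \<tau>, of 1] by (simp add: Vir_def commutator_algebra_def)
  have \<tau>_eq: "\<tau> h = h \<odot>\<^bsub>U\<^esub> ?w" for h
    using hom_scale[OF \<tau>, of 1 h] by (simp add: Vir_def commutator_algebra_def)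
  have loc3: "lcoef U ?w ?w n = \<zero>\<^bsub>U\<^esub>" if "n \<ge> 3" for n
    using loc that by (simp add: locality_le_iff[OF U.lcoef_finite[OF w w]])
  let ?p = "lcoef U ?w ?w"
  have p [simp]: "?p n \<in> carrier U" for n by (rule U.lcoef_closed[OF w w])
  have "lcoef Vir 1 1 1 = (2 :: 'k poly)"
    by (simp add: lcoef_Vir Vir_bracket_generator numeral_poly)
  then have "2 \<odot>\<^bsub>U\<^esub> ?w = ?p 1 \<ominus>\<^bsub>U\<^esub> subst_neg U ?p 1"
    using hom_lcoef[OF \<tau>, of 1 1 1]
    by (simp add: \<tau>_eq[of 2] commutator_lcoef) (simp add: Vir_def)
  also have "subst_neg U ?p 1 = (\<Oplus>\<^bsub>U\<^esub>n\<in>{0, 1, 2}. coeff ([:- T_H, -1:] ^ n) 1 \<odot>\<^bsub>U\<^esub> ?p n)"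
    by (rule U.subst_neg_superset) (auto simp: loc3)
  also have "\<dots> = (- 1) \<odot>\<^bsub>U\<^esub> ?p 1 \<oplus>\<^bsub>U\<^esub> (2 * T_H) \<odot>\<^bsub>U\<^esub> ?p 2"
    by (simp add: power2_eq_square numeral_poly)
  also have "?p 1 \<ominus>\<^bsub>U\<^esub> \<dots> = 1 \<odot>\<^bsub>U\<^esub> ?p 1 \<oplus>\<^bsub>U\<^esub> (1 \<odot>\<^bsub>U\<^esub> ?p 1 \<oplus>\<^bsub>U\<^esub> (- (2 * T_H)) \<odot>\<^bsub>U\<^esub> ?p 2)"
    unfolding U.scalar_uminus[OF p, of "2 * T_H" 2]
    by (simp add: U.M.minus_eq U.M.minus_add U.scalar_uminus)
  also have "\<dots> = (1 + 1) \<odot>\<^bsub>U\<^esub> ?p 1 \<oplus>\<^bsub>U\<^esub> (- (2 * T_H)) \<odot>\<^bsub>U\<^esub> ?p 2"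
    by (simp only: U.scalar_add[OF p] U.M.a_assoc[OF U.scalar_closed[OF p] U.scalar_closed[OF p] U.scalar_closed[OF p]])
  finally have *: "2 \<odot>\<^bsub>U\<^esub> ?w = 2 \<odot>\<^bsub>U\<^esub> ?p 1 \<oplus>\<^bsub>U\<^esub> (- (2 * T_H)) \<odot>\<^bsub>U\<^esub> ?p 2" by simp
  have half: "[:1/2:] * 2 = (1 :: 'k poly)" by (simp add: numeral_poly)
  have "?w = ([:1/2:] * 2) \<odot>\<^bsub>U\<^esub> ?w" unfolding half using w by simp
  also have "\<dots> = [:1/2:] \<odot>\<^bsub>U\<^esub> (2 \<odot>\<^bsub>U\<^esub> ?p 1 \<oplus>\<^bsub>U\<^esub> (- (2 * T_H)) \<odot>\<^bsub>U\<^esub> ?p 2)"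
    by (simp only: U.scalar_mult[OF w] *)
  also have "\<dots> = ([:1/2:] * 2) \<odot>\<^bsub>U\<^esub> ?p 1 \<oplus>\<^bsub>U\<^esub> (- (([:1/2:] * 2) * T_H)) \<odot>\<^bsub>U\<^esub> ?p 2"
    by (simp only: U.scalar_right_add U.scalar_closed p mult.assoc mult_minus_right flip: U.scalar_mult)
  also have "\<dots> = ?p 1 \<ominus>\<^bsub>U\<^esub> T_H \<odot>\<^bsub>U\<^esub> ?p 2"
    unfolding half mult_1_left U.scalar_uminus[OF p] by (simp add: U.M.minus_eq)
  finally have diff: "?w = ?p 1 \<ominus>\<^bsub>U\<^esub> T_H \<odot>\<^bsub>U\<^esub> ?p 2" .
  have "a = b \<oplus>\<^bsub>U\<^esub> x" if "b = a \<ominus>\<^bsub>U\<^esub> x" "a \<in> carrier U" "x \<in> carrier U" for a b x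
    using that by (simp add: U.M.minus_eq U.M.a_assoc U.M.l_neg)
  from this[OF diff p U.scalar_closed[OF p]]
  have "?p (Suc 0) = ?w \<oplus>\<^bsub>U\<^esub> T_H \<odot>\<^bsub>U\<^esub> ?p 2" unfolding One_nat_def .
  with w loc3 show "virasoro_generator U ?w"
    by unfold_locales (simp_all only:)
  show "generated_by U {?w} = carrier U"
  proof
    show "generated_by U {?w} \<subseteq> carrier U"
      by (rule U.subalgebra_subset[OF U.generated_by_subalgebra]) (use w in simp)
    have "\<tau> h \<in> B" if "conformal_subalgebra B U" "?w \<in> B" for h B
      unfolding \<tau>_eq[of h] by (rule U.subalgebra_scale[OF that])
    then show "carrier U \<subseteq> generated_by U {?w}"
      unfolding gen[symmetric] generated_by_def by blast
  qed
qed

text \<open>In terms of values, \<open>L\<^sub>0\<close> acts as multiplication by \<open>x\<close>, and on elements that do not involve \<open>T\<close> and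
  \<open>x\<close>, such as the images of the \<open>L\<^sub>1\<^sup>k p\<^sub>2\<close>, \<open>L\<^sub>1\<close> acts as composition with \<open>D\<close>. The image of \<open>p\<^sub>2\<close> is
  \<open>D - D\<^sup>2\<close>.\<close>
lemma ev_hom_word:
  fixes U :: "('k::field_char_0, 'u) conformal"
  assumes V: "virasoro_generator U w" and \<phi>: "\<phi> \<in> conformal_hom U A_V" and w: "\<phi> w = tau_v"
  shows "ev (\<phi> (virasoro_generator.word U w (m, n))) s y u =
    y ^ n \<cdot> (case m of 0 \<Rightarrow> y \<cdot> u - s \<cdot> weight_op u
      | Suc k \<Rightarrow> (weight_op ^^ Suc k) u - (weight_op ^^ Suc (Suc k)) u)"
proof -
  interpret V: virasoro_generator U w by (rule V)
  have \<phi>_closed: "\<phi> c \<in> carrier Cend_fin" if "c \<in> carrier U" for c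
    using hom_closed[OF \<phi> that] Cend.subalgebra_subset[OF A_V_subalgebra] by (auto simp: A_V_def)
  have \<phi>_L: "\<phi> (V.L k c) = cend_lcoef tau_v (\<phi> c) k" if "c \<in> carrier U" for k c
    using hom_lcoef[OF \<phi> V.w_closed that] by (simp add: V.L_def w A_V_def)
  have comm: "weight_op ((weight_op ^^ k) u) = (weight_op ^^ k) (weight_op u)" for k and u :: "'k poly"
    by (simp add: funpow_swap1)
  have e: "ev (\<phi> ((V.L (Suc 0) ^^ k) (V.L 2 w))) s y u =
      (weight_op ^^ Suc k) u - (weight_op ^^ Suc (Suc k)) u" for k s y u
  proof (induction k arbitrary: s y u)
    case 0
    show ?case by (simp add: \<phi>_L w ev_lcoef_tau_v)
  next
    case (Suc k)
    have "(V.L (Suc 0) ^^ k) (V.L 2 w) \<in> carrier U" by (intro V.funpow_L_closed) simp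
    from ev_tau_v_product_1[OF \<phi>_closed[OF this] Suc.IH] this show ?case
      by (simp add: \<phi>_L weight_op_diff)
  qed
  show ?thesis
  proof (induction n)
    case 0
    show ?case by (cases m) (simp_all only: V.word_def fst_conv snd_conv funpow_0 nat.case
          w ev_tau_v e power_0 smult_1_left)
  next
    case (Suc n)
    then show ?case
      by (simp only: V.word_Suc \<phi>_L V.word_closed ev_tau_v_product_0 \<phi>_closed power_Suc smult_smult)
  qed
qed

theorem mainTheorem2:
  fixes U :: "('k::field_char_0, 'u) conformal" and \<tau>\<^sub>U :: "'k poly \<Rightarrow> 'u"
  assumes "universal_envelope TYPE('k cend) Vir 1 3 U \<tau>\<^sub>U"
  shows "\<exists>\<phi>. \<phi> \<in> conformal_iso A_V U"
proof -
  have env: "assoc_envelope Vir U \<tau>\<^sub>U" and loc: "locality U (\<tau>\<^sub>U 1) (\<tau>\<^sub>U 1) \<le> 3"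
    and univ: "\<And>(A :: ('k, 'k cend) conformal) \<tau>.
        assoc_envelope Vir A \<tau> \<Longrightarrow> locality A (\<tau> 1) (\<tau> 1) \<le> 3 \<Longrightarrow>
        \<exists>\<phi>\<in>conformal_hom U A. \<forall>c\<in>carrier Vir. \<tau> c = \<phi> (\<tau>\<^sub>U c)"
    using assms unfolding universal_envelope_def by blast+
  let ?w = "\<tau>\<^sub>U 1"
  interpret U: virasoro_generator U ?w by (rule envelope_generator[OF env loc])
  interpret A: assoc_conformal_algebra "A_V :: ('k, 'k cend) conformal" by (rule A_V_assoc)
  have "lie_conformal_algebra (Vir :: ('k, 'k poly) conformal)"
    using env by (simp add: assoc_envelope_def)
  from univ[OF A_V_envelope[OF this]]
  obtain \<phi> where \<phi>: "\<phi> \<in> conformal_hom U A_V"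
    and \<phi>\<tau>: "\<And>c. c \<in> carrier Vir \<Longrightarrow> c \<odot>\<^bsub>Cend_fin\<^esub> tau_v = \<phi> (\<tau>\<^sub>U c)"
    by (auto simp: tau_v_closed A_V_locality)
  have w: "\<phi> ?w = tau_v" using \<phi>\<tau>[of 1] by (simp add: tau_v_closed Vir_def)
  have \<phi>_closed: "\<phi> c \<in> carrier Cend_fin" if "c \<in> carrier U" for c
    using hom_closed[OF \<phi> that] Cend.subalgebra_subset[OF A_V_subalgebra] by (auto simp: A_V_def)
  have \<phi>_zero: "\<phi> \<zero>\<^bsub>U\<^esub> = \<zero>\<^bsub>Cend_fin\<^esub>"
    using hom_scale[OF \<phi>, of "\<zero>\<^bsub>U\<^esub>" 0] \<phi>_closed[of "\<zero>\<^bsub>U\<^esub>"] by (simp add: A_V_def)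
  have surj: "carrier A_V \<subseteq> \<phi> ` carrier U"
  proof -
    have "conformal_subalgebra (\<phi> ` carrier U) Cend_fin"
      using hom_image_subalgebra[OF U.lambda_algebra_axioms A.lambda_algebra_axioms \<phi>]
      unfolding A_V_def by (rule Cend.subalgebra_of_subalgebra[OF A_V_subalgebra])
    moreover have "tau_v \<in> \<phi> ` carrier U" using w U.w_closed by (metis imageI)
    ultimately show ?thesis by (auto simp: A_V_def generated_by_def)
  qed
  have kernel: "x = \<zero>\<^bsub>U\<^esub>" if x: "x \<in> carrier U" and \<phi>x: "\<phi> x = \<zero>\<^bsub>Cend_fin\<^esub>" for x
  proof -
    have "x \<in> U.hspan U.word"
      using x U.carrier_eq_hspan[OF envelope_generator(2)[OF env loc]] by simp
    from U.hspan_combination[OF U.word_closed this]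
    obtain I c where I: "finite I" and xI: "x = (\<Oplus>\<^bsub>U\<^esub>i\<in>I. c i \<odot>\<^bsub>U\<^esub> U.word i)"
      by (elim exE conjE)
    have "ev (\<phi> (\<Oplus>\<^bsub>U\<^esub>i\<in>I. c i \<odot>\<^bsub>U\<^esub> U.word i)) s y u =
        (\<Sum>i\<in>I. poly (c i) s \<cdot> ev (\<phi> (U.word i)) s y u)" for s y u
      using I
    proof (induction I rule: finite_induct)
      case empty
      show ?case by (simp add: \<phi>_zero ev_zero)
    next
      case (insert j J)
      have "\<phi> (c j \<odot>\<^bsub>U\<^esub> U.word j \<oplus>\<^bsub>U\<^esub> (\<Oplus>\<^bsub>U\<^esub>i\<in>J. c i \<odot>\<^bsub>U\<^esub> U.word i)) =
          c j \<odot>\<^bsub>Cend_fin\<^esub> \<phi> (U.word j) \<oplus>\<^bsub>Cend_fin\<^esub> \<phi> (\<Oplus>\<^bsub>U\<^esub>i\<in>J. c i \<odot>\<^bsub>U\<^esub> U.word i)"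
        using hom_add[OF \<phi>] hom_scale[OF \<phi>] by (simp add: A_V_def)
      with insert show ?case by (simp add: ev_add ev_scale \<phi>_closed cend_scale_closed)
    qed
    then have zero: "(\<Sum>i\<in>I. poly (c i) s \<cdot> ev (\<phi> (U.word i)) s y 1) = 0" for s y
      using \<phi>x by (simp add: ev_zero flip: xI)
    have weight_form_word: "weight_form z (ev (\<phi> (U.word i)) s y 1) = y ^ snd i *
        (case fst i of 0 \<Rightarrow> y - s * z | Suc k \<Rightarrow> z ^ Suc k - z ^ Suc (Suc k))" for i s y z
    proof -
      have "U.word i = U.word (fst i, snd i)" by simp
      then show ?thesis
        by (simp only: ev_hom_word[OF U.virasoro_generator_axioms \<phi> w])
          (simp add: weight_form_scale weight_form_diff weight_form_weight_op weight_form_weight_op_power del: smult_one split: nat.split)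
    qed
    have "c i = 0" if "i \<in> I" for i
    proof (rule words_independent[OF I _ that])
      show "(\<Sum>i\<in>I. poly (c i) s * (y ^ snd i *
        (case fst i of 0 \<Rightarrow> y - s * z | Suc k \<Rightarrow> z ^ Suc k - z ^ Suc (Suc k)))) = 0" for s y z
        using arg_cong[OF zero[of s y], of "weight_form z"]
        by (simp add: weight_form_sum weight_form_scale weight_form_word) (simp add: weight_form_def)
    qed
    then have "x = (\<Oplus>\<^bsub>U\<^esub>i\<in>I. \<zero>\<^bsub>U\<^esub>)"
      unfolding xI by (intro U.finsum_cong') auto
    then show ?thesis by simp
  qed
  have inj: "inj_on \<phi> (carrier U)"
  proof (rule inj_onI)
    fix a b assume [simp]: "a \<in> carrier U" "b \<in> carrier U" and eq: "\<phi> a = \<phi> b"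
    have "\<phi> (a \<ominus>\<^bsub>U\<^esub> b) = \<phi> a \<oplus>\<^bsub>Cend_fin\<^esub> (- 1) \<odot>\<^bsub>Cend_fin\<^esub> \<phi> b"
      using hom_add[OF \<phi>, of a "(- 1) \<odot>\<^bsub>U\<^esub> b"] hom_scale[OF \<phi>, of b "- 1"]
      by (simp add: a_minus_def U.minus_eq_scalar A_V_def)
    also have "\<dots> = \<zero>\<^bsub>Cend_fin\<^esub>"
      using \<phi>_closed[of b] by (simp add: eq Cend.r_neg flip: Cend.minus_eq_scalar)
    finally have "a \<ominus>\<^bsub>U\<^esub> b = \<zero>\<^bsub>U\<^esub>" by (intro kernel) auto
    then have "\<ominus>\<^bsub>U\<^esub> (\<ominus>\<^bsub>U\<^esub> b) = a" by (intro U.M.minus_equality) (auto simp: a_minus_def)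
    then show "a = b" by simp
  qed
  have "\<phi> \<in> conformal_iso U A_V"
    unfolding conformal_iso_def bij_betw_def using \<phi> inj surj hom_closed[OF \<phi>] by auto
  then show ?thesis
    using conformal_iso_inverse[OF U.lambda_algebra_axioms A.lambda_algebra_axioms] by blast
qed

end
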